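(* Let $F_2$ be the free group with free basis $\{x_1,x_2\}$, let $u\in F_2$, $u\neq 1$, and let $O_{\mathrm{Aut}\,F_2}(u)=\{\alpha(u):\alpha\in \mathrm{Aut}\,F_2\}$ be its automorphic orbit. If an endomorphism $\phi$ of $F_2$ preserves this orbit, i.e. $\phi(O_{\mathrm{Aut}\,F_2}(u))\subseteq O_{\mathrm{Aut}\,F_2}(u)$, then $\phi$ is an automorphism of $F_2$. *)

theory Defs
  imports "HOL-Algebra.Algebra"
begin

text \<open>The free group F_2 on the basis {x1, x2}, realised as reduced words.
  A letter is a pair (g, inv): g = False means x1, g = True means x2;
  inv = True means the inverse of that generator.\<close>

type_synonym letter2 = "bool \<times> bool"

definition canceling :: "letter2 \<Rightarrow> letter2 \<Rightarrow> bool" where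
  "canceling a b \<longleftrightarrow> fst a = fst b \<and> snd a \<noteq> snd b"

fun reduced :: "letter2 list \<Rightarrow> bool" where
  "reduced [] = True"
| "reduced [a] = True"
| "reduced (a # b # ws) \<longleftrightarrow> \<not> canceling a b \<and> reduced (b # ws)"

definition reduce :: "letter2 list \<Rightarrow> letter2 list" where
  "reduce xs = foldr (\<lambda>a ys. case ys of [] \<Rightarrow> [a]
                     | b # zs \<Rightarrow> (if canceling a b then zs else a # ys)) xs []"

definition F2 :: "letter2 list monoid" where
  "F2 = \<lparr> carrier = {w. reduced w}, monoid.mult = (\<lambda>x y. reduce (x @ y)), monoid.one = [] \<rparr>"

definition x1 :: "letter2 list" where "x1 = [(False, False)]"
definition x2 :: "letter2 list" where "x2 = [(True, False)]"

definition aut_orbit :: "letter2 list \<Rightarrow> letter2 list set" where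
  "aut_orbit u = {\<alpha> u | \<alpha>. \<alpha> \<in> iso F2 F2}"

end

theory Submission
  imports Defs
begin

text \<open>Precomposing \<phi> with a suitable automorphism makes the images of the two generators a Nielsen
  reduced pair, or kills one generator. In the second case the image is cyclic, and Euclid's
  algorithm on exponent sums produces an element of the orbit in the kernel, which is impossible.
  So \<phi> is injective. Suppose that it is not surjective. After composing with an automorphism it
  fixes u, so u lies in the images of all its iterates. In a Nielsen reduced basis
  of the image of the n-th iterate, every basis element that occurs in u is at most as long as u.
  These images are pairwise different, so for some n only one basis element occurs in u; pulling
  back along the n-th iterate, which fixes u, makes u a power of a primitive element.
  Roots being unique, \<phi> then preserves primitivity.

  It remains to treat the primitive case. Normalise to \<phi>(x1) = x1 and \<phi>(x2) = y, where y starts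
  and ends with a power of x2. The words x1^k y are cyclically reduced and primitive for k nonzero.
  A primitive element with exponent sums (a, b) is conjugate, up to changing the signs of the
  generators, to a positive word and hence has cyclic length at most |a| + |b|. Letting k tend to
  infinity in both directions forces y to be a power of x2, hence x2 or its inverse.\<close>

section \<open>Words, homomorphisms and lengths\<close>

definition inv_letter :: "letter2 \<Rightarrow> letter2" where
  "inv_letter a = (fst a, \<not> snd a)"

lemma inv_letter_simps [simp]:
  "inv_letter (inv_letter a) = a" "inv_letter (g, s) = (g, \<not> s)"
  "fst (inv_letter a) = fst a" "snd (inv_letter a) \<longleftrightarrow> \<not> snd a" "inv_letter a \<noteq> a"
  "a \<noteq> inv_letter a" "inv_letter a = inv_letter b \<longleftrightarrow> a = b"
  by (auto simp: inv_letter_def prod_eq_iff)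

lemma canceling_iff: "canceling a b \<longleftrightarrow> b = inv_letter a"
  by (auto simp: canceling_def inv_letter_def prod_eq_iff)

lemma reduced_Cons:
  "reduced (a # w) \<longleftrightarrow> reduced w \<and> (w \<noteq> [] \<longrightarrow> hd w \<noteq> inv_letter a)"
  by (cases w) (auto simp: canceling_iff)

lemma reduced_append:
  "reduced (v @ w) \<longleftrightarrow>
    reduced v \<and> reduced w \<and> (v \<noteq> [] \<longrightarrow> w \<noteq> [] \<longrightarrow> hd w \<noteq> inv_letter (last v))"
  by (induction v) (auto simp: reduced_Cons)

text \<open>One letter acting on reduced words by left multiplication; \<open>reduce\<close>
  iterates it. Each letter acts as a permutation (\<open>act_act_inv\<close>), which is van der
  Waerden's way to associativity without a confluence argument.\<close>

definition act :: "letter2 \<Rightarrow> letter2 list \<Rightarrow> letter2 list" where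
  "act a w = (case w of [] \<Rightarrow> [a] | b # v \<Rightarrow> if canceling a b then v else a # w)"

lemma reduce_eq_foldr_act: "reduce w = foldr act w []"
  unfolding reduce_def act_def ..

lemma act_Cons: "act a (b # w) = (if b = inv_letter a then w else a # b # w)"
  by (simp add: act_def canceling_iff)

lemma reduced_act: "reduced w \<Longrightarrow> reduced (act a w)"
  by (cases w) (auto simp: act_def reduced_Cons canceling_iff)

lemma act_eq_Cons: "reduced (a # w) \<Longrightarrow> act a w = a # w"
  by (cases w) (auto simp: act_def)

lemma act_act_inv: "reduced w \<Longrightarrow> act a (act (inv_letter a) w) = w"
  by (cases w) (auto simp: act_def canceling_iff reduced_Cons split: list.split)

lemma reduced_foldr_act: "reduced w \<Longrightarrow> reduced (foldr act v w)"
  by (induction v) (auto simp: reduced_act)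

lemma reduced_reduce: "reduced (reduce w)"
  by (simp add: reduce_eq_foldr_act reduced_foldr_act)

lemma reduce_reduced: "reduced w \<Longrightarrow> reduce w = w"
  by (induction w) (auto simp: reduce_eq_foldr_act act_eq_Cons reduced_Cons)

lemma foldr_act_act:
  assumes "reduced w"
  shows "foldr act (act a v) w = act a (foldr act v w)"
proof (cases v)
  case (Cons b v')
  then show ?thesis
    using act_act_inv[OF reduced_foldr_act[OF assms], of a v'] by (auto simp: act_Cons)
qed (simp add: act_def)

text \<open>This becomes associativity: reducing the left factor first does not change how it acts
  on reduced words.\<close>

lemma foldr_act_foldr_act:
  "reduced w \<Longrightarrow> foldr act (foldr act u v) w = foldr act u (foldr act v w)"
  by (induction u) (auto simp: foldr_act_act)

lemma reduce_append: "reduce (v @ w) = foldr act v (reduce w)"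
  by (simp add: reduce_eq_foldr_act)

definition inv_word :: "letter2 list \<Rightarrow> letter2 list" where
  "inv_word w = rev (map inv_letter w)"

lemma reduced_inv_word: "reduced w \<Longrightarrow> reduced (inv_word w)"
  by (induction w) (auto simp: inv_word_def reduced_append reduced_Cons last_rev hd_map)

lemma reduce_inv_word: "reduced w \<Longrightarrow> reduce (inv_word w @ w) = []"
proof (induction w)
  case (Cons a w)
  then have "reduced w" by (simp add: reduced_Cons)
  moreover have "reduce (inv_letter a # a # w) = act (inv_letter a) (reduce (a # w))"
    by (simp add: reduce_eq_foldr_act)
  then have "reduce (inv_letter a # a # w) = w"
    using Cons.prems by (simp add: reduce_reduced act_def canceling_iff)
  ultimately show ?case
    using Cons.IH by (simp add: inv_word_def reduce_append reduce_reduced foldr_append)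
qed (simp add: inv_word_def reduce_eq_foldr_act)

text \<open>The free group is written additively, although it is not commutative: the only type class
  for possibly noncommutative groups is the additive one.\<close>

typedef free2 = "{w. reduced w}"
  by (rule exI[of _ "[]"]) simp

lemma reduced_Rep [simp]: "reduced (Rep_free2 w)"
  using Rep_free2 by blast

lemma Rep_Abs [simp]: "reduced w \<Longrightarrow> Rep_free2 (Abs_free2 w) = w"
  by (simp add: Abs_free2_inverse)

instantiation free2 :: group_add
begin

definition zero_free2 :: free2 where
  "0 = Abs_free2 []"

definition plus_free2 :: "free2 \<Rightarrow> free2 \<Rightarrow> free2" where
  "v + w = Abs_free2 (reduce (Rep_free2 v @ Rep_free2 w))"

definition uminus_free2 :: "free2 \<Rightarrow> free2" where
  "- w = Abs_free2 (inv_word (Rep_free2 w))"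

definition minus_free2 :: "free2 \<Rightarrow> free2 \<Rightarrow> free2" where
  "v - w = v + - (w :: free2)"

instance
proof
  fix u v w :: free2
  show "u + v + w = u + (v + w)"
    by (simp add: plus_free2_def reduced_reduce reduce_append foldr_act_foldr_act
        reduced_foldr_act reduce_reduced)
  show "0 + u = u"
    by (simp add: plus_free2_def zero_free2_def reduce_reduced Rep_free2_inverse)
  show "u + 0 = u"
    by (simp add: plus_free2_def zero_free2_def reduce_reduced Rep_free2_inverse)
  show "- u + u = 0"
    by (simp add: plus_free2_def zero_free2_def uminus_free2_def reduced_inv_word reduce_inv_word)
  show "u + - v = u - v"
    by (simp add: minus_free2_def)
qed

end

lemma Rep_zero: "Rep_free2 0 = []"
  by (simp add: zero_free2_def)

lemma Rep_plus: "Rep_free2 (v + w) = reduce (Rep_free2 v @ Rep_free2 w)"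
  by (simp add: plus_free2_def reduced_reduce)

lemma Rep_uminus: "Rep_free2 (- w) = inv_word (Rep_free2 w)"
  by (simp add: uminus_free2_def reduced_inv_word)

definition letter :: "letter2 \<Rightarrow> free2" where
  "letter a = Abs_free2 [a]"

lemma Rep_letter: "Rep_free2 (letter a) = [a]"
  by (simp add: letter_def)

lemma letter_inv: "letter (inv_letter a) = - letter a"
  by (simp add: Rep_free2_inject[symmetric] Rep_letter Rep_uminus inv_word_def)

lemma Rep_letter_plus: "Rep_free2 (letter a + w) = act a (Rep_free2 w)"
  by (simp add: Rep_plus Rep_letter reduce_eq_foldr_act)
     (metis reduce_eq_foldr_act reduce_reduced reduced_Rep)

lemma Rep_plus_reduced:
  "reduced (Rep_free2 v @ Rep_free2 w) \<Longrightarrow> Rep_free2 (v + w) = Rep_free2 v @ Rep_free2 w"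
  by (simp add: Rep_plus reduce_reduced)

lemma Rep_ConsE:
  assumes "Rep_free2 w = a # v"
  obtains w' where "w = letter a + w'" "Rep_free2 w' = v"
proof
  have r: "reduced (a # v)" using assms reduced_Rep by metis
  then show "Rep_free2 (Abs_free2 v) = v" by (simp add: reduced_Cons)
  then show "w = letter a + Abs_free2 v"
    using r assms by (simp add: Rep_free2_inject[symmetric] Rep_letter_plus act_eq_Cons)
qed

lemma free2_induct [case_names zero letter_plus]:
  assumes "P 0"
    and "\<And>a w. P w \<Longrightarrow> Rep_free2 (letter a + w) = a # Rep_free2 w \<Longrightarrow> P (letter a + w)"
  shows "P w"
proof (induction "Rep_free2 w" arbitrary: w)
  case Nil
  then have "w = 0" by (simp add: Rep_free2_inject[symmetric] Rep_zero)
  then show ?case using assms(1) by simp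
next
  case (Cons a v)
  from Cons.hyps(2)[symmetric] obtain w' where "w = letter a + w'" "Rep_free2 w' = v"
    by (rule Rep_ConsE)
  then show ?case using assms(2)[of w' a] Cons by auto
qed

section \<open>Homomorphisms and the universal property\<close>

definition gen1 :: free2 where "gen1 = letter (False, False)"
definition gen2 :: free2 where "gen2 = letter (True, False)"

definition grp_hom :: "('a::group_add \<Rightarrow> 'b::group_add) \<Rightarrow> bool" where
  "grp_hom f \<longleftrightarrow> (\<forall>v w. f (v + w) = f v + f w)"

lemma grp_hom_plus: "grp_hom f \<Longrightarrow> f (v + w) = f v + f w"
  by (simp add: grp_hom_def)

lemma grp_hom_zero: "grp_hom f \<Longrightarrow> f 0 = 0"
  using grp_hom_plus[of f 0 0] add_left_imp_eq[of "f 0" "f 0" 0] by simp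

lemma grp_hom_uminus: "grp_hom f \<Longrightarrow> f (- v) = - f v"
  using grp_hom_plus[of f v "- v"] minus_unique[of "f v" "f (- v)"] by (simp add: grp_hom_zero)

lemma grp_hom_minus: "grp_hom f \<Longrightarrow> f (v - w) = f v - f w"
  using grp_hom_plus[of f v "- w"] by (simp add: grp_hom_uminus)

lemmas grp_hom_simps = grp_hom_plus grp_hom_zero grp_hom_uminus grp_hom_minus

lemma grp_hom_comp: "grp_hom f \<Longrightarrow> grp_hom g \<Longrightarrow> grp_hom (f \<circ> g)"
  by (simp add: grp_hom_def)

lemma grp_hom_id: "grp_hom id"
  by (simp add: grp_hom_def)

text \<open>Letters index the four elements p, -p, q, -q, with \<open>inv_letter\<close> matching
  negation. Conditions on a basis and its inverses thus become conditions on letters.\<close>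

definition letter_val :: "'a::group_add \<Rightarrow> 'a \<Rightarrow> letter2 \<Rightarrow> 'a" where
  "letter_val p q a = (let g = if fst a then q else p in if snd a then - g else g)"

lemma letter_val_simps [simp]:
  "letter_val p q (False, False) = p" "letter_val p q (False, True) = - p"
  "letter_val p q (True, False) = q" "letter_val p q (True, True) = - q"
  by (auto simp: letter_val_def)

lemma letter_val_inv: "letter_val p q (inv_letter a) = - letter_val p q a"
  by (auto simp: letter_val_def Let_def)

definition ext_word :: "'a::group_add \<Rightarrow> 'a \<Rightarrow> letter2 list \<Rightarrow> 'a" where
  "ext_word p q w = foldr (\<lambda>a. (+) (letter_val p q a)) w 0"

text \<open>The universal property of the free group; by \<open>grp_hom_eq_ext\<close> every
  homomorphism has this form.\<close>

definition ext :: "'a::group_add \<Rightarrow> 'a \<Rightarrow> free2 \<Rightarrow> 'a" where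
  "ext p q w = ext_word p q (Rep_free2 w)"

lemma ext_word_append: "ext_word p q (v @ w) = ext_word p q v + ext_word p q w"
  by (induction v) (auto simp: ext_word_def add.assoc)

lemma ext_word_act: "ext_word p q (act a w) = letter_val p q a + ext_word p q w"
proof (cases w)
  case (Cons b v)
  then show ?thesis
    by (cases "b = inv_letter a") (auto simp: act_Cons ext_word_def letter_val_inv)
qed (simp add: act_def ext_word_def)

lemma ext_word_reduce: "ext_word p q (reduce w) = ext_word p q w"
proof (induction w)
  case (Cons a w)
  have "reduce (a # w) = act a (reduce w)" by (simp add: reduce_eq_foldr_act)
  then have "ext_word p q (reduce (a # w)) = letter_val p q a + ext_word p q w"
    by (simp add: ext_word_act Cons.IH)
  then show ?case by (simp add: ext_word_def)
qed (simp add: reduce_eq_foldr_act)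

lemma grp_hom_ext: "grp_hom (ext p q)"
  by (simp add: grp_hom_def ext_def Rep_plus ext_word_reduce ext_word_append)

lemmas ext_simps = grp_hom_simps[OF grp_hom_ext]

lemma ext_letter: "ext p q (letter a) = letter_val p q a"
  by (simp add: ext_def Rep_letter ext_word_def)

lemma ext_gen [simp]: "ext p q gen1 = p" "ext p q gen2 = q"
  by (auto simp: gen1_def gen2_def ext_letter)

lemma letter_eq_letter_val: "letter a = letter_val gen1 gen2 a"
  by (cases a) (auto simp: letter_val_def gen1_def gen2_def letter_inv[symmetric] Let_def)

lemma grp_hom_letter:
  assumes "grp_hom f" shows "f (letter a) = letter_val (f gen1) (f gen2) a"
  by (simp add: letter_eq_letter_val letter_val_def Let_def grp_hom_uminus[OF assms])

lemma grp_hom_eq_ext: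
  assumes "grp_hom f" shows "f = ext (f gen1) (f gen2)"
proof
  show "f w = ext (f gen1) (f gen2) w" for w
    by (induction w rule: free2_induct)
       (simp_all add: ext_simps grp_hom_simps[OF assms] ext_letter grp_hom_letter[OF assms])
qed

lemma grp_hom_eqI:
  assumes "grp_hom f" "grp_hom g" "f gen1 = g gen1" "f gen2 = g gen2"
  shows "f = g"
  using grp_hom_eq_ext[OF assms(1)] grp_hom_eq_ext[OF assms(2)] assms(3,4) by simp

section \<open>Length and cancellation\<close>

definition len :: "free2 \<Rightarrow> nat" where
  "len w = length (Rep_free2 w)"

fun lcp :: "'a list \<Rightarrow> 'a list \<Rightarrow> nat" where
  "lcp (a # v) (b # w) = (if a = b then Suc (lcp v w) else 0)"
| "lcp _ _ = 0"

text \<open>The Gromov product at the identity of the Cayley tree: by \<open>len_diff\<close>, this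
  many letters of each factor cancel in \<open>- v + w\<close>. \<open>cp_ultrametric\<close> is the
  tree property on which the Nielsen arguments rest.\<close>

definition cp :: "free2 \<Rightarrow> free2 \<Rightarrow> nat" where
  "cp v w = lcp (Rep_free2 v) (Rep_free2 w)"

lemma len_zero [simp]: "len 0 = 0"
  by (simp add: len_def Rep_zero)

lemma len_eq_0_iff [simp]: "len w = 0 \<longleftrightarrow> w = 0"
  by (simp add: len_def Rep_free2_inject[symmetric] Rep_zero)

lemma len_uminus [simp]: "len (- w) = len w"
  by (simp add: len_def Rep_uminus inv_word_def)

lemma len_letter [simp]: "len (letter a) = 1"
  by (simp add: len_def Rep_letter)

lemma lcp_commute: "lcp v w = lcp w v"
  by (induction v w rule: lcp.induct) auto

lemma lcp_le: "lcp v w \<le> length v"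
  by (induction v w rule: lcp.induct) auto

lemma lcp_ultrametric: "min (lcp u v) (lcp v w) \<le> lcp u w"
proof (induction u v arbitrary: w rule: lcp.induct)
  case (1 a u b v)
  then show ?case by (cases w) auto
qed auto

lemma lcp_nth: "i < lcp v w \<Longrightarrow> v ! i = w ! i"
proof (induction v w arbitrary: i rule: lcp.induct)
  case (1 a v b w)
  then show ?case by (cases i) (auto split: if_splits)
qed auto

lemma cp_commute: "cp v w = cp w v"
  by (simp add: cp_def lcp_commute)

lemma cp_le1: "cp v w \<le> len v" and cp_le2: "cp v w \<le> len w"
  using lcp_le[of "Rep_free2 v" "Rep_free2 w"] lcp_le[of "Rep_free2 w" "Rep_free2 v"]
  by (auto simp: cp_def len_def lcp_commute)

lemma cp_self [simp]: "cp v v = len v"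
proof -
  have "lcp w w = length w" for w :: "letter2 list" by (induction w) auto
  then show ?thesis by (simp add: cp_def len_def)
qed

lemma cp_ultrametric: "min (cp u v) (cp v w) \<le> cp u w"
  by (simp only: cp_def lcp_ultrametric)

lemma len_diff: "len (- v + w) + 2 * cp v w = len v + len w"
proof (induction "Rep_free2 v" "Rep_free2 w" arbitrary: v w rule: lcp.induct)
  case (1 a v' b w')
  note eqs = 1(2,3)[symmetric]
  obtain v0 where v0: "v = letter a + v0" "Rep_free2 v0 = v'" using eqs(1) by (rule Rep_ConsE)
  obtain w0 where w0: "w = letter b + w0" "Rep_free2 w0 = w'" using eqs(2) by (rule Rep_ConsE)
  show ?case
  proof (cases "a = b")
    case True
    then have "- v + w = - v0 + w0"
      by (simp only: v0(1) w0(1) minus_add add.assoc minus_add_cancel)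
    then show ?thesis
      using 1(1)[OF True v0(2)[symmetric] w0(2)[symmetric]] True eqs v0(2) w0(2)
      by (simp add: cp_def len_def)
  next
    case False
    have "reduced (Rep_free2 (- v) @ Rep_free2 w)"
      unfolding reduced_append Rep_uminus
      using False eqs reduced_Rep[of w] reduced_inv_word[OF reduced_Rep[of v]]
      by (simp add: inv_word_def)
    then show ?thesis
      using Rep_plus_reduced[of "- v" w] False eqs
      by (simp add: len_def cp_def Rep_uminus inv_word_def)
  qed
next
  case ("2_1" v w)
  then have "v = 0" by (simp add: Rep_free2_inject[symmetric] Rep_zero)
  then show ?case by (simp add: cp_def Rep_zero)
next
  case ("2_2" v w)
  then have "w = 0" by (simp add: Rep_free2_inject[symmetric] Rep_zero)
  then show ?case by (simp add: cp_def Rep_zero lcp_commute[of _ "[]"])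
qed

lemma len_plus: "len (v + w) + 2 * cp (- v) w = len v + len w"
  using len_diff[of "- v" w] by simp

lemma len_plus_le: "len (v + w) \<le> len v + len w"
  using len_plus[of v w] by linarith

text \<open>Where w agrees with its inverse, each letter is inverse to its mirror image. If the
  agreement reached the middle, a letter would be its own inverse (odd length) or two adjacent
  letters would cancel (even length).\<close>

lemma cp_uminus_self_less:
  assumes "w \<noteq> 0"
  shows "2 * cp w (- w) < len w"
proof (rule ccontr)
  assume *: "\<not> ?thesis"
  define v where "v = Rep_free2 w"
  define n where "n = length v"
  have n: "n > 0" using assms len_eq_0_iff[of w] by (simp add: n_def v_def len_def)
  have le: "n \<le> 2 * cp w (- w)" using * by (simp add: n_def v_def len_def)
  have mirror: "v ! i = inv_letter (v ! (n - 1 - i))" if "i < cp w (- w)" for i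
  proof -
    have "i < n" using that cp_le1[of w "- w"] by (simp add: n_def v_def len_def)
    then have "inv_word v ! i = inv_letter (v ! (n - 1 - i))"
      by (simp add: inv_word_def rev_nth n_def)
    then show ?thesis
      using lcp_nth[of i v "inv_word v"] that by (simp add: cp_def v_def Rep_uminus)
  qed
  show False
  proof (cases "even n")
    case True
    then obtain k where k: "n = 2 * k" by blast
    with n le have "v ! (k - 1) = inv_letter (v ! k)"
      using mirror[of "k - 1"] by (simp add: k)
    moreover have "reduced (take k v @ drop k v)" by (simp add: v_def)
    then have "v ! k \<noteq> inv_letter (v ! (k - 1))"
      using k n unfolding reduced_append
      by (auto simp: n_def hd_drop_conv_nth last_conv_nth min_def)
    ultimately show False by simp
  next
    case False
    then obtain k where k: "n = 2 * k + 1" using oddE by blast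
    then show False using le mirror[of k] inv_letter_simps(5)[of "v ! k"] by auto
  qed
qed

section \<open>Nielsen reduction\<close>

text \<open>The classical conditions: a neighbour in a product cancels at most half of a basis
  element, and the neighbours on both sides together never cancel all of it. The left neighbour
  enters through its inverse, the letter b. The second condition also excludes 0.\<close>

definition nielsen_reduced :: "free2 \<Rightarrow> free2 \<Rightarrow> bool" where
  "nielsen_reduced p q \<longleftrightarrow>
    (\<forall>a b. a \<noteq> b \<longrightarrow> 2 * cp (letter_val p q a) (letter_val p q b) \<le> len (letter_val p q a)) \<and>
    (\<forall>a b c. b \<noteq> a \<longrightarrow> c \<noteq> inv_letter a \<longrightarrow>
      cp (letter_val p q a) (letter_val p q b) + cp (- letter_val p q a) (letter_val p q c)
        < len (letter_val p q a))"

text \<open>The first clause strengthens the induction: the product keeps more of its first factor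
  than any other basis element or inverse shares with that factor, so what cancels against a
  preceding factor depends on the first factor alone.\<close>

lemma nielsen_reduced_ext_word:
  assumes "nielsen_reduced p q" and "reduced (a # w)"
  shows "(\<forall>c. c \<noteq> a \<longrightarrow>
        cp (letter_val p q a) (letter_val p q c) < cp (letter_val p q a) (ext_word p q (a # w)))
    \<and> len (letter_val p q a) \<le> len (ext_word p q (a # w))
    \<and> len (ext_word p q w) \<le> len (ext_word p q (a # w))"
  using assms(2)
proof (induction w arbitrary: a)
  case Nil
  have "cp (letter_val p q a) (letter_val p q c) < len (letter_val p q a)" if "c \<noteq> a" for c a
    using assms(1) that inv_letter_simps(5)[of a] unfolding nielsen_reduced_def
    by (metis add_lessD1)
  then show ?case by (simp add: ext_word_def)
next
  case (Cons b w)
  let ?V = "letter_val p q"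
  define v where "v = ext_word p q (b # w)"
  have W: "ext_word p q (a # b # w) = ?V a + v" by (simp add: v_def ext_word_def)
  have red: "reduced (b # w)" and ba: "b \<noteq> inv_letter a"
    using Cons.prems by (simp_all add: reduced_Cons)
  have IH1: "cp (?V b) (?V c) < cp (?V b) v" if "c \<noteq> b" for c
    using Cons.IH[OF red] that unfolding v_def by blast
  have IH2: "len (?V b) \<le> len v"
    using Cons.IH[OF red] by (simp add: v_def)
  have "cp (?V b) (- ?V a) < cp (?V b) v"
    using IH1[of "inv_letter a"] ba by (simp add: letter_val_inv)
  \<comment> \<open>\<open>v\<close> agrees with \<open>?V b\<close> beyond the point where
    \<open>- ?V a\<close> leaves \<open>?V b\<close>, so by the ultrametric inequality both cancel
    equally against \<open>?V a\<close>.\<close>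
  then have cpv: "cp (- ?V a) v = cp (- ?V a) (?V b)"
    using cp_ultrametric[of "- ?V a" v "?V b"] cp_ultrametric[of "- ?V a" "?V b" v]
    by (simp add: cp_commute)
  have n1: "2 * cp (?V b) (?V (inv_letter a)) \<le> len (?V b)"
    "2 * cp (?V (inv_letter a)) (?V b) \<le> len (?V (inv_letter a))"
    using assms(1) ba unfolding nielsen_reduced_def by metis+
  have n2: "cp (?V a) (?V c) + cp (- ?V a) (?V b) < len (?V a)" if "c \<noteq> a" for c
    using assms(1) ba that unfolding nielsen_reduced_def by metis
  have l1: "len (?V a + v) + 2 * cp (- ?V a) v = len (?V a) + len v"
    by (rule len_plus)
  \<comment> \<open>With \<open>l1\<close> this says that exactly \<open>cp (- ?V a) v\<close>
    letters of \<open>?V a\<close> are lost, and \<open>n2\<close> bounds that number.\<close>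
  have l2: "len v + 2 * cp (?V a) (?V a + v) = len (?V a) + len (?V a + v)"
    using len_diff[of "?V a" "?V a + v"] by (simp only: minus_add_cancel)
  have "\<forall>c. c \<noteq> a \<longrightarrow> cp (?V a) (?V c) < cp (?V a) (ext_word p q (a # b # w))"
  proof (intro allI impI)
    fix c assume "c \<noteq> a"
    then show "cp (?V a) (?V c) < cp (?V a) (ext_word p q (a # b # w))"
      using n2[of c] l1 l2 cpv unfolding W by linarith
  qed
  moreover have "len (?V a) \<le> len (ext_word p q (a # b # w))"
    using n1 IH2 l1 cpv unfolding W by (simp add: letter_val_inv cp_commute)
  moreover have "len (ext_word p q (b # w)) \<le> len (ext_word p q (a # b # w))"
    using n1 l1 cpv unfolding W v_def[symmetric] by (simp add: letter_val_inv)
  ultimately show ?case by blast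
qed

text \<open>Dropping first factors never lengthens the product, and each factor comes first at some
  point.\<close>

lemma nielsen_reduced_len_le:
  assumes "nielsen_reduced p q" and "a \<in> set (Rep_free2 w)"
  shows "len (letter_val p q a) \<le> len (ext p q w)"
proof -
  have "reduced v \<Longrightarrow> a \<in> set v \<Longrightarrow> len (letter_val p q a) \<le> len (ext_word p q v)" for v
  proof (induction v)
    case (Cons b v)
    then show ?case
      using nielsen_reduced_ext_word[OF assms(1) Cons.prems(1)]
      by (auto simp: reduced_Cons intro: order_trans)
  qed simp
  then show ?thesis using assms(2) by (simp add: ext_def)
qed

lemma nielsen_reduced_letter_val_nonzero:
  assumes "nielsen_reduced p q" shows "letter_val p q a \<noteq> 0"
proof
  assume "letter_val p q a = 0"
  moreover have "cp (letter_val p q a) (letter_val p q (inv_letter a))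
      + cp (- letter_val p q a) (letter_val p q a) < len (letter_val p q a)"
    using assms inv_letter_simps(5)[of a] unfolding nielsen_reduced_def by metis
  ultimately show False by simp
qed

lemma inj_if_kernel_trivial:
  assumes "grp_hom f" and "\<And>w. f w = 0 \<Longrightarrow> w = 0" shows "inj f"
proof (rule injI)
  fix v w assume "f v = f w"
  then have "f (v - w) = 0" by (simp add: grp_hom_minus[OF assms(1)])
  then show "v = w" using assms(2)[of "v - w"] by simp
qed

lemma inj_ext_nielsen_reduced:
  assumes "nielsen_reduced p q" shows "inj (ext p q)"
proof (rule inj_if_kernel_trivial[OF grp_hom_ext])
  fix w assume *: "ext p q w = 0"
  show "w = 0"
  proof (cases "Rep_free2 w")
    case (Cons a v)
    then have "len (letter_val p q a) \<le> len (ext p q w)"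
      by (intro nielsen_reduced_len_le[OF assms]) simp
    then show ?thesis using * nielsen_reduced_letter_val_nonzero[OF assms, of a] by simp
  qed (simp add: Rep_free2_inject[symmetric] Rep_zero)
qed

text \<open>Abstracts from the pairs of values of a homomorphism on the bases reached by Nielsen
  automorphisms, so that a pair of minimal length can be chosen without tracking
  automorphisms.\<close>

definition nielsen_closed :: "(free2 \<times> free2) set \<Rightarrow> bool" where
  "nielsen_closed R \<longleftrightarrow>
    (\<forall>p q. (p, q) \<in> R \<longrightarrow> (q, p) \<in> R \<and> (- p, q) \<in> R \<and> (p + q, q) \<in> R)"

lemma nielsen_closed_letter_val:
  assumes "nielsen_closed R" "(p, q) \<in> R" "fst a \<noteq> fst b"
  shows "(letter_val p q a, letter_val p q b) \<in> R"
proof -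
  have *: "(v, - w) \<in> R" if "(v, w) \<in> R" for v w
    using assms(1) that unfolding nielsen_closed_def by blast
  show ?thesis
    using assms * unfolding nielsen_closed_def by (cases a; cases b) (auto simp: letter_val_def)
qed

lemma nielsen_closed_letter_diff:
  assumes "nielsen_closed R" "(p, q) \<in> R" "fst a \<noteq> fst b"
  shows "(- letter_val p q a + letter_val p q b, letter_val p q b) \<in> R"
  using nielsen_closed_letter_val[OF assms(1,2), of "inv_letter a" b] assms
  unfolding nielsen_closed_def by (simp add: letter_val_inv)

definition len_minimal :: "(free2 \<times> free2) set \<Rightarrow> free2 \<Rightarrow> free2 \<Rightarrow> bool" where
  "len_minimal R p q \<longleftrightarrow>
    (p, q) \<in> R \<and> (\<forall>p' q'. (p', q') \<in> R \<longrightarrow> len p + len q \<le> len p' + len q')"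

lemma len_letter_val: "len (letter_val p q a) = (if fst a then len q else len p)"
  by (simp add: letter_val_def)

text \<open>If more than half of the element at a cancelled, replacing the element at b by its
  inverse followed by the element at a would shorten the pair.\<close>

lemma len_minimal_letters:
  assumes "nielsen_closed R" "len_minimal R p q" "fst a \<noteq> fst b"
  shows "2 * cp (letter_val p q a) (letter_val p q b) \<le> len (letter_val p q a)"
proof -
  have "len p + len q \<le> len (- letter_val p q a + letter_val p q b) + len (letter_val p q b)"
    using nielsen_closed_letter_diff[OF assms(1) _ assms(3)] assms(2)
    unfolding len_minimal_def by blast
  moreover have "len (- letter_val p q b + letter_val p q a) = len (- letter_val p q a + letter_val p q b)"
    using len_uminus[of "- letter_val p q a + letter_val p q b"] by (simp add: minus_add)
  moreover have "len p + len q \<le> len (- letter_val p q b + letter_val p q a) + len (letter_val p q a)"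
    using nielsen_closed_letter_diff[OF assms(1), of p q b a] assms(2,3)
    unfolding len_minimal_def by metis
  ultimately show ?thesis
    using len_diff[of "letter_val p q a" "letter_val p q b"] assms(3)
    by (auto simp: len_letter_val split: if_splits)
qed

text \<open>Minimality and \<open>cp_uminus_self_less\<close> give the first Nielsen condition, so
  the second one fails, and only if exactly half of an element cancels on each side. The letters b
  and c responsible belong to the other generator. They differ, since otherwise half of the element
  would agree with half of its inverse; so they are mutually inverse.\<close>

lemma len_minimal_cases:
  assumes "nielsen_closed R" "len_minimal R p q" "p \<noteq> 0" "q \<noteq> 0" "\<not> nielsen_reduced p q"
  obtains a b where "fst a \<noteq> fst b"
    "2 * cp (letter_val p q a) (letter_val p q b) = len (letter_val p q a)"
    "2 * cp (- letter_val p q a) (- letter_val p q b) = len (letter_val p q a)"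
proof -
  let ?V = "letter_val p q"
  have nz: "?V a \<noteq> 0" for a using assms(3,4) by (simp add: letter_val_def)
  have less: "2 * cp (?V a) (- ?V a) < len (?V a)" for a
    by (rule cp_uminus_self_less[OF nz])
  have other: "b = inv_letter a" if "a \<noteq> b" "fst a = fst b" for a b
    using that by (auto simp: prod_eq_iff)
  have half: "2 * cp (?V a) (?V b) \<le> len (?V a)" if "a \<noteq> b" for a b
  proof (cases "fst a = fst b")
    case True
    then show ?thesis using less[of a] other[OF that True] by (simp add: letter_val_inv)
  qed (rule len_minimal_letters[OF assms(1,2)])
  then obtain a b c where abc: "b \<noteq> a" "c \<noteq> inv_letter a"
    "len (?V a) \<le> cp (?V a) (?V b) + cp (- ?V a) (?V c)"
    using assms(5) unfolding nielsen_reduced_def by (meson not_less)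
  have h: "2 * cp (?V a) (?V b) \<le> len (?V a)" "2 * cp (- ?V a) (?V c) \<le> len (?V a)"
    using half[of a b] half[of "inv_letter a" c] abc(1,2) by (auto simp: letter_val_inv)
  have eq: "2 * cp (?V a) (?V b) = len (?V a)" "2 * cp (- ?V a) (?V c) = len (?V a)"
    using h abc(3) by linarith+
  have fb: "fst a \<noteq> fst b"
  proof
    assume "fst a = fst b"
    then have "?V b = - ?V a" using other[of a b] abc(1) by (simp add: letter_val_inv)
    then show False using eq(1) less[of a] by simp
  qed
  have fc: "fst a \<noteq> fst c"
  proof
    assume "fst a = fst c"
    then have "c = a" using other[of "inv_letter a" c] abc(2) by simp
    then show False using eq(2) less[of a] by (simp add: cp_commute)
  qed
  have "b \<noteq> c"
  proof
    assume "b = c"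
    then show False
      using cp_ultrametric[of "?V a" "?V b" "- ?V a"] eq less[of a] by (simp add: cp_commute)
  qed
  moreover have "fst b = fst c" using fb fc by auto
  ultimately have "c = inv_letter b" by (rule other)
  then show ?thesis using that[OF fb eq(1)] eq(2) by (simp add: letter_val_inv)
qed

text \<open>A pair of minimal total length can fail to be Nielsen reduced only if one element is
  absorbed half by half by its neighbours on both sides. One further length-preserving
  transformation repairs this, so no tie-breaking order on words is needed.\<close>

lemma nielsen_reduced_exists:
  assumes "nielsen_closed R" "R \<noteq> {}"
  shows "\<exists>p q. (p, q) \<in> R \<and> (q = 0 \<or> nielsen_reduced p q)"
proof -
  obtain r where "r \<in> R" and r: "\<And>r'. r' \<in> R \<Longrightarrow> len (fst r) + len (snd r) \<le> len (fst r') + len (snd r')"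
    using ex_has_least_nat[of "\<lambda>r. r \<in> R" _ "\<lambda>r. len (fst r) + len (snd r)"] assms(2) by blast
  then have "len_minimal R (fst r) (snd r)"
    unfolding len_minimal_def by fastforce
  then obtain p q where min: "len_minimal R p q" by blast
  then have R: "(p, q) \<in> R" by (simp add: len_minimal_def)
  show ?thesis
  proof (cases "p = 0 \<or> q = 0 \<or> nielsen_reduced p q")
    case True
    then show ?thesis using R assms(1) unfolding nielsen_closed_def by blast
  next
    case False
    then obtain a b where ab: "fst a \<noteq> fst b"
      "2 * cp (letter_val p q a) (letter_val p q b) = len (letter_val p q a)"
      "2 * cp (- letter_val p q a) (- letter_val p q b) = len (letter_val p q a)"
      using len_minimal_cases[OF assms(1) min] by blast
    define x where "x = letter_val p q a"
    define y where "y = letter_val p q b"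
    \<comment> \<open>The halves of x form the start and the end of y: x = p + s and y = p + m + s.
      Then z = - s - m + s has the length of y, so replacing y by z keeps the pair minimal.\<close>
    define z where "z = - y + x"
    have nz: "x \<noteq> 0" "y \<noteq> 0" using False by (simp_all add: x_def y_def letter_val_def)
    have xy: "2 * cp x y = len x" "2 * cp (- x) (- y) = len x"
      using ab(2,3) by (simp_all add: x_def y_def)
    have lenz: "len z = len y"
      using len_diff[of y x] xy(1) by (simp add: z_def cp_commute)
    have "len p + len q = len x + len y"
      using ab(1) by (auto simp: x_def y_def len_letter_val)
    moreover have zR: "(z, x) \<in> R"
      unfolding z_def x_def y_def using nielsen_closed_letter_diff[OF assms(1) R] ab(1) by metis
    ultimately have minz: "len_minimal R z x"
      using min lenz unfolding len_minimal_def by (simp add: add.commute)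
    have "z \<noteq> 0" using lenz nz len_eq_0_iff by metis
    have "nielsen_reduced z x"
    proof (rule ccontr)
      assume "\<not> nielsen_reduced z x"
      then obtain c d where cd: "fst c \<noteq> fst d"
        "2 * cp (letter_val z x c) (letter_val z x d) = len (letter_val z x c)"
        "2 * cp (- letter_val z x c) (- letter_val z x d) = len (letter_val z x c)"
        using len_minimal_cases[OF assms(1) minz \<open>z \<noteq> 0\<close> nz(1)] by blast
      have ylen: "len x \<le> len y" using xy(1) cp_le2[of x y] 
        len_minimal_letters[OF assms(1) min, of b a] ab(1) by (simp add: x_def y_def cp_commute)
      have "len (- (- y) + z) = len x" by (simp add: z_def)
      then have "2 * cp (- y) z + len x = 2 * len y"
        using len_diff[of "- y" z] lenz by simp
      then have yz: "len x \<le> 2 * cp (- y) z" using ylen by linarith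
      have "len (- (- z) + - x) = len y" by (simp add: z_def)
      then have 1: "2 * cp (- z) (- x) = len x"
        using len_diff[of "- z" "- x"] lenz by simp
      have "2 * cp z (- x) \<le> len x"
        using len_minimal_letters[OF assms(1) minz, of "(True, True)" "(False, False)"]
        by (simp add: cp_commute)
      then have 2: "2 * cp z (- x) = len x"
        using cp_ultrametric[of z "- y" "- x"] yz xy(2) by (simp add: cp_commute)
      \<comment> \<open>Both z and - z share half of - x with - x, hence neither shares half of x
        with x. Every way for the new pair to fail would pair x with z or - z.\<close>
      note less = cp_uminus_self_less[OF nz(1)] cp_uminus_self_less[OF \<open>z \<noteq> 0\<close>]
      have "2 * cp x z < len x" "2 * cp x (- z) < len x" "2 * cp z (- x) < len z"
        using cp_ultrametric[of x z "- x"] cp_ultrametric[of x "- z" "- x"]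
          cp_ultrametric[of z "- x" "- z"] less 1 2
        by (simp_all add: cp_commute)
      note facts = this cp_commute[of z x] cp_commute[of "- z" x]
        cp_commute[of "- z" "- x"] cp_commute[of z "- x"]
      have "letter_val z x c \<in> {x, - x} \<and> letter_val z x d \<in> {z, - z} \<or>
          letter_val z x c \<in> {z, - z} \<and> letter_val z x d \<in> {x, - x}"
        using cd(1) by (auto simp: letter_val_def)
      then show False
        using cd(2,3) facts 1 2 ylen lenz by (elim disjE conjE insertE emptyE) simp_all
    qed
    then show ?thesis using zR by blast
  qed
qed

section \<open>Automorphisms and Nielsen generators\<close>

definition nu :: "free2 \<Rightarrow> free2" where "nu = ext (gen1 + gen2) gen2"
definition swap_gens :: "free2 \<Rightarrow> free2" where "swap_gens = ext gen2 gen1"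
definition inv_gen1 :: "free2 \<Rightarrow> free2" where "inv_gen1 = ext (- gen1) gen2"

text \<open>Generators are composed on the right: for a homomorphism precomposed with f, the values
  at \<open>gen1\<close> and \<open>gen2\<close> then undergo exactly the moves of
  \<open>nielsen_closed\<close>.\<close>

inductive nielsen :: "(free2 \<Rightarrow> free2) \<Rightarrow> bool" where
  nielsen_id: "nielsen id"
| nielsen_nu: "nielsen f \<Longrightarrow> nielsen (f \<circ> nu)"
| nielsen_swap: "nielsen f \<Longrightarrow> nielsen (f \<circ> swap_gens)"
| nielsen_inv: "nielsen f \<Longrightarrow> nielsen (f \<circ> inv_gen1)"

definition aut :: "(free2 \<Rightarrow> free2) \<Rightarrow> bool" where
  "aut f \<longleftrightarrow> grp_hom f \<and> bij f"

lemma autD: "aut f \<Longrightarrow> grp_hom f" "aut f \<Longrightarrow> bij f" "aut f \<Longrightarrow> inj f" "aut f \<Longrightarrow> surj f"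
  by (auto simp: aut_def bij_def)

lemma aut_comp: "aut f \<Longrightarrow> aut g \<Longrightarrow> aut (f \<circ> g)"
  by (auto simp: aut_def grp_hom_comp bij_comp)

lemma aut_id: "aut id"
  by (simp add: aut_def grp_hom_id)

lemma aut_inv: 
  assumes "aut f" shows "aut (inv_into UNIV f)"
proof -
  have "inv_into UNIV f (v + w) = inv_into UNIV f v + inv_into UNIV f w" for v w
  proof -
    have "f (inv_into UNIV f (v + w)) = f (inv_into UNIV f v + inv_into UNIV f w)"
      using autD[OF assms] by (simp add: surj_f_inv_f grp_hom_plus)
    then show ?thesis using autD(3)[OF assms] by (simp add: inj_eq)
  qed
  then show ?thesis using autD(2)[OF assms] by (simp add: aut_def grp_hom_def bij_imp_bij_inv)
qed

lemma autI:
  assumes "grp_hom f" "grp_hom g"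
    and "f (g gen1) = gen1" "f (g gen2) = gen2" "g (f gen1) = gen1" "g (f gen2) = gen2"
  shows "aut f"
proof -
  have "f \<circ> g = id" "g \<circ> f = id"
    by (rule grp_hom_eqI; simp add: grp_hom_comp grp_hom_id assms)+
  then show ?thesis using assms(1) o_bij by (auto simp: aut_def)
qed

lemma aut_nielsen_gens: "aut nu" "aut swap_gens" "aut inv_gen1"
proof -
  show "aut nu" unfolding nu_def
    by (rule autI[of _ "ext (gen1 - gen2) gen2"]) (simp_all add: grp_hom_ext ext_simps)
  show "aut swap_gens" unfolding swap_gens_def
    by (rule autI[of _ "ext gen2 gen1"]) (simp_all add: grp_hom_ext ext_simps)
  show "aut inv_gen1" unfolding inv_gen1_def
    by (rule autI[of _ "ext (- gen1) gen2"]) (simp_all add: grp_hom_ext ext_simps)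
qed

lemma aut_nielsen: "nielsen f \<Longrightarrow> aut f"
  by (induction rule: nielsen.induct) (blast intro: aut_id aut_comp aut_nielsen_gens)+

text \<open>The form of Nielsen reduction used from here on. In the first alternative the image of f
  is cyclic.\<close>

lemma nielsen_reduction:
  assumes "grp_hom f"
  obtains g where "nielsen g" "f (g gen2) = 0 \<or> nielsen_reduced (f (g gen1)) (f (g gen2))"
proof -
  define R where "R = {(f (g gen1), f (g gen2)) | g. nielsen g}"
  have "(q, p) \<in> R \<and> (- p, q) \<in> R \<and> (p + q, q) \<in> R" if pq: "(p, q) \<in> R" for p q
  proof -
    obtain g where g: "nielsen g" "p = f (g gen1)" "q = f (g gen2)"
      using pq unfolding R_def by auto
    note gh = autD(1)[OF aut_nielsen[OF g(1)]]
    have "(f ((g \<circ> h) gen1), f ((g \<circ> h) gen2)) \<in> R" if "h = nu \<or> h = swap_gens \<or> h = inv_gen1" for h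
      using that g(1) nielsen.intros unfolding R_def by blast
    from this[of nu] this[of swap_gens] this[of inv_gen1] show ?thesis
      by (simp_all add: nu_def swap_gens_def inv_gen1_def g(2,3) grp_hom_simps[OF gh] grp_hom_simps[OF assms])
  qed
  then have "nielsen_closed R" by (simp add: nielsen_closed_def)
  moreover have "R \<noteq> {}" unfolding R_def using nielsen_id by blast
  ultimately obtain p q where "(p, q) \<in> R" "q = 0 \<or> nielsen_reduced p q"
    using nielsen_reduced_exists by blast
  then show ?thesis using that unfolding R_def by auto
qed

section \<open>Fixed points of proper monomorphisms\<close>

primrec npow :: "nat \<Rightarrow> 'a::group_add \<Rightarrow> 'a" where
  "npow 0 x = 0"
| "npow (Suc n) x = x + npow n x"

lemma npow_Suc_right: "npow (Suc n) x = npow n x + x"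
proof (induction n)
  case (Suc n)
  have "npow (Suc (Suc n)) x = x + (npow n x + x)" by (simp only: npow.simps(2)[of "Suc n"] Suc)
  then show ?case by (simp only: npow.simps(2)[of n] add.assoc)
qed simp

lemma grp_hom_npow: "grp_hom f \<Longrightarrow> f (npow n x) = npow n (f x)"
  by (induction n) (simp_all add: grp_hom_simps)

lemma npow_int: "npow n (i::int) = int n * i"
  by (induction n) (simp_all add: algebra_simps)

lemma npow_conj: "npow n (g + x - g) = g + npow n x - g"
proof (induction n)
  case (Suc n)
  then show ?case by (simp only: npow.simps diff_conv_add_uminus add.assoc minus_add_cancel)
qed simp

definition zpow :: "int \<Rightarrow> 'a::group_add \<Rightarrow> 'a" where
  "zpow i x = (if 0 \<le> i then npow (nat i) x else - npow (nat (- i)) x)"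

lemma zpow_0 [simp]: "zpow 0 x = 0"
  by (simp add: zpow_def)

lemma zpow_add_one: "zpow (1 + i) x = x + zpow i x"
proof (cases "0 \<le> i")
  case True
  then have "nat (1 + i) = Suc (nat i)" by simp
  then show ?thesis using True by (simp add: zpow_def)
next
  case False
  then have n: "nat (- i) = Suc (nat (- 1 - i))" by simp
  have "zpow i x = - (npow (nat (- 1 - i)) x + x)"
    using False unfolding zpow_def n npow_Suc_right by simp
  then have "x + zpow i x = - npow (nat (- 1 - i)) x"
    by (simp only: minus_add add_minus_cancel)
  then show ?thesis using False by (auto simp: zpow_def)
qed

lemma zpow_diff_one: "zpow (- 1 + i) x = - x + zpow i x"
  using zpow_add_one[of "- 1 + i" x] by simp

lemma zpow_add: "zpow (i + j) x = zpow i x + zpow j x"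
proof (induction i rule: int_induct[of _ 0])
  case (step1 i)
  have "zpow (i + 1 + j) x = x + (zpow i x + zpow j x)"
    using zpow_add_one[of "i + j" x] step1.IH by (simp add: ac_simps)
  then show ?case using zpow_add_one[of i x] by (simp add: add.assoc add.commute[of 1])
next
  case (step2 i)
  have "zpow (i - 1 + j) x = - x + (zpow i x + zpow j x)"
    using zpow_diff_one[of "i + j" x] step2.IH by (simp add: algebra_simps)
  then show ?case using zpow_diff_one[of i x]
    by (simp add: add.assoc[symmetric] add.commute[of "- 1"] del: uminus_add_conv_diff)
qed simp

lemma grp_hom_zpow: "grp_hom f \<Longrightarrow> f (zpow i x) = zpow i (f x)"
  by (simp add: zpow_def grp_hom_simps grp_hom_npow)

lemma zpow_int: "zpow i (j::int) = i * j"
  by (simp add: zpow_def npow_int)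

section \<open>Exponent sums, the coordinates of the abelianisation\<close>

definition exp1 :: "free2 \<Rightarrow> int" where "exp1 = ext 1 0"
definition exp2 :: "free2 \<Rightarrow> int" where "exp2 = ext 0 1"

lemma grp_hom_exp: "grp_hom exp1" "grp_hom exp2"
  by (simp_all add: exp1_def exp2_def grp_hom_ext)

lemma exp_gen [simp]: "exp1 gen1 = 1" "exp1 gen2 = 0" "exp2 gen1 = 0" "exp2 gen2 = 1"
  by (simp_all add: exp1_def exp2_def)

lemmas exp_simps = grp_hom_simps[OF grp_hom_exp(1)] grp_hom_simps[OF grp_hom_exp(2)]

lemma grp_hom_int_exp:
  assumes "grp_hom (h :: free2 \<Rightarrow> int)"
  shows "h w = h gen1 * exp1 w + h gen2 * exp2 w"
proof -
  define k where "k w = h gen1 * exp1 w + h gen2 * exp2 w" for w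
  have "grp_hom k"
    by (simp add: k_def grp_hom_def exp_simps algebra_simps)
  then have "h = k" by (rule grp_hom_eqI[OF assms]) (simp_all add: k_def)
  then have "h w = k w" by (rule fun_cong)
  then show ?thesis by (simp only: k_def)
qed

lemma exp_ext:
  "exp1 (ext x y w) = exp1 x * exp1 w + exp1 y * exp2 w"
  "exp2 (ext x y w) = exp2 x * exp1 w + exp2 y * exp2 w"
  using grp_hom_int_exp[OF grp_hom_comp[OF grp_hom_exp(1) grp_hom_ext[of x y]], of w]
    grp_hom_int_exp[OF grp_hom_comp[OF grp_hom_exp(2) grp_hom_ext[of x y]], of w]
  by simp_all

lemma ext_zero_right: "ext p 0 w = zpow (exp1 w) p"
proof (induction w rule: free2_induct)
  case (letter_plus a w)
  then show ?case
    by (cases a rule: prod.exhaust)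
       (auto simp: ext_simps ext_letter letter_val_def exp_simps grp_hom_letter[OF grp_hom_exp(1)]
         zpow_add_one zpow_diff_one Let_def simp del: add_uminus_conv_diff uminus_add_conv_diff)
qed (simp add: ext_simps exp_simps)

lemma grp_hom_gen2_zero:
  assumes "grp_hom f" "f gen2 = 0" shows "f w = zpow (exp1 w) (f gen1)"
  using grp_hom_eq_ext[OF assms(1)] assms(2) ext_zero_right[of "f gen1" w] by metis

text \<open>Euclid's algorithm as a minimality argument. The shears \<open>sh\<close> and
  \<open>sh'\<close> add or subtract one exponent sum to or from the other; if neither decreases the
  sum of absolute values, one exponent sum is 0, and a swap puts it first.\<close>

lemma exists_aut_exp1_zero: "\<exists>f. aut f \<and> exp1 (f u) = 0"
proof -
  define m where "m f = nat (\<bar>exp1 (f u)\<bar> + \<bar>exp2 (f u)\<bar>)" for f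
  obtain f where f: "aut f" and min: "\<And>g. aut g \<Longrightarrow> m f \<le> m g"
    using ex_has_least_nat[of aut id m] aut_id by blast
  define sh where "sh e = ext (gen1 + zpow e gen2) gen2" for e
  define sh' where "sh' e = ext gen1 (gen2 + zpow e gen1)" for e
  have z: "zpow (- 1) x = - x" "zpow 1 x = x" for x :: free2
    using zpow_diff_one[of 0 x] zpow_add_one[of 0 x] by simp_all
  have aut: "aut (sh e)" "aut (sh' e)" if "e = 1 \<or> e = - 1" for e
  proof -
    show "aut (sh e)" unfolding sh_def
      by (rule autI[of _ "ext (gen1 + zpow (- e) gen2) gen2"])
         (use that in \<open>auto simp: grp_hom_ext ext_simps z\<close>)
    show "aut (sh' e)" unfolding sh'_def
      by (rule autI[of _ "ext gen1 (gen2 + zpow (- e) gen1)"])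
         (use that in \<open>auto simp: grp_hom_ext ext_simps z\<close>)
  qed
  have mle: "m f \<le> m (sh e \<circ> f)" "m f \<le> m (sh' e \<circ> f)" if "e = 1 \<or> e = - 1" for e
    using min aut_comp[OF aut(1)[OF that] f] aut_comp[OF aut(2)[OF that] f] by blast+
  have sh_exp: "exp1 (sh e w) = exp1 w" "exp2 (sh e w) = e * exp1 w + exp2 w"
    "exp1 (sh' e w) = exp1 w + e * exp2 w" "exp2 (sh' e w) = exp2 w" for e w
    by (simp_all add: sh_def sh'_def exp_ext exp_simps grp_hom_zpow[OF grp_hom_exp(1)]
        grp_hom_zpow[OF grp_hom_exp(2)] zpow_int)
  have le: "\<bar>exp2 (f u)\<bar> \<le> \<bar>e * exp1 (f u) + exp2 (f u)\<bar>"
    "\<bar>exp1 (f u)\<bar> \<le> \<bar>exp1 (f u) + e * exp2 (f u)\<bar>" if "e = 1 \<or> e = - 1" for e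
    using mle[OF that] by (simp_all add: m_def sh_exp nat_le_eq_zle)
  have "exp1 (f u) = 0 \<or> exp2 (f u) = 0"
  proof -
    have "a = 0 \<or> b = 0"
      if "\<bar>b\<bar> \<le> \<bar>a + b\<bar>" "\<bar>b\<bar> \<le> \<bar>b - a\<bar>" "\<bar>a\<bar> \<le> \<bar>a + b\<bar>" "\<bar>a\<bar> \<le> \<bar>a - b\<bar>" for a b :: int
      using that by (simp add: abs_if split: if_splits)
    then show ?thesis using le[of 1] le[of "- 1"] by simp
  qed
  then show ?thesis
  proof
    assume "exp2 (f u) = 0"
    then have "exp1 ((swap_gens \<circ> f) u) = 0" by (simp add: swap_gens_def exp_ext)
    then show ?thesis using aut_comp[OF aut_nielsen_gens(2) f] by blast
  qed (use f in blast)
qed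

section \<open>Orbits, fixed points and roots\<close>

definition preserves_orbit :: "(free2 \<Rightarrow> free2) \<Rightarrow> free2 \<Rightarrow> bool" where
  "preserves_orbit f u \<longleftrightarrow> (\<forall>g. aut g \<longrightarrow> (\<exists>h. aut h \<and> f (g u) = h u))"

lemma aut_inv_simps:
  assumes "aut f"
  shows "f (inv_into UNIV f w) = w" "inv_into UNIV f (f w) = w"
  using autD[OF assms] by (simp_all add: surj_f_inv_f)

text \<open>After g, the map f factors through the first exponent sum. The orbit contains an element
  whose preimage under g has first exponent sum 0; f kills it, but must send it into the orbit of
  u.\<close>

lemma preserves_orbit_kernel:
  assumes "grp_hom f" "preserves_orbit f u" "aut g" "f (g gen2) = 0"
  shows "u = 0"
proof -
  obtain h where h: "aut h" "exp1 (h u) = 0" using exists_aut_exp1_zero by blast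
  have "(f \<circ> g) (h u) = 0"
    using grp_hom_gen2_zero[OF grp_hom_comp[OF assms(1) autD(1)[OF assms(3)]], of "h u"] assms(4) h(2)
    by simp
  moreover obtain h' where h': "aut h'" "f ((g \<circ> h) u) = h' u"
    using assms(2) aut_comp[OF assms(3) h(1)] unfolding preserves_orbit_def by blast
  ultimately have "h' u = h' 0" by (simp add: grp_hom_simps[OF autD(1)[OF h'(1)]])
  then show ?thesis using autD(3)[OF h'(1)] by (simp add: inj_eq)
qed

lemma Rep_npow_letter: "Rep_free2 (npow k (letter a)) = replicate k a"
proof (induction k)
  case (Suc k)
  have "act a (replicate k a) = a # replicate k a"
    by (cases k) (simp_all add: act_def canceling_iff)
  then show ?case by (simp add: Rep_letter_plus Suc)
qed (simp add: Rep_zero)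

lemma reduced_same_generator:
  assumes "reduced w" "\<And>a. a \<in> set w \<Longrightarrow> fst a = c"
  obtains k s where "w = replicate k (c, s)"
proof -
  have "\<exists>k s. w = replicate k (c, s)"
    using assms
  proof (induction w)
    case (Cons a w)
    then obtain k s where w: "w = replicate k (c, s)" by (auto simp: reduced_Cons)
    have a: "a = (c, snd a)" using Cons.prems(2)[of a] by (simp add: prod_eq_iff)
    show ?case
    proof (cases k)
      case 0
      then show ?thesis using a w by (intro exI[of _ 1]) auto
    next
      case (Suc j)
      then have "(c, s) \<noteq> inv_letter a" using Cons.prems(1) w by (simp add: reduced_Cons)
      then have "a = (c, s)" using a by (cases a) auto
      then show ?thesis using w by (metis replicate_Suc)
    qed
  qed simp
  then show ?thesis using that by blast
qed

lemma letter_eq_aut_gen1: "\<exists>f. aut f \<and> letter a = f gen1"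
proof -
  have "aut (swap_gens \<circ> inv_gen1)" "(swap_gens \<circ> inv_gen1) gen1 = - gen2"
    using aut_comp aut_nielsen_gens by (simp_all add: swap_gens_def inv_gen1_def ext_simps)
  moreover have "swap_gens gen1 = gen2" "inv_gen1 gen1 = - gen1" "id gen1 = gen1"
    by (simp_all add: swap_gens_def inv_gen1_def)
  ultimately show ?thesis
    using aut_nielsen_gens aut_id letter_eq_letter_val[of a]
    unfolding letter_val_def Let_def by metis
qed

lemma finite_len_le: "finite {w. len w \<le> n}"
proof (rule finite_imageD)
  show "finite (Rep_free2 ` {w. len w \<le> n})"
    by (rule finite_subset[OF _ finite_lists_length_le[of UNIV n]]) (auto simp: len_def)
  show "inj_on Rep_free2 {w. len w \<le> n}" by (simp add: inj_on_def Rep_free2_inject)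
qed

lemma fixed_by_proper_mono:
  assumes "grp_hom f" "inj f" "\<not> surj f" "f u = u" "u \<noteq> 0"
  obtains g k where "aut g" "k > 0" "u = npow k (g gen1)"
proof -
  have hom: "grp_hom (f ^^ n)" for n
    by (induction n) (auto simp: grp_hom_def grp_hom_plus[OF assms(1)])
  have injn: "inj (f ^^ n)" for n
    by (rule inj_fn[OF assms(2)])
  have fixn: "(f ^^ n) u = u" for n
    by (induction n) (auto simp: assms(4))
  have "\<exists>g. nielsen g \<and> nielsen_reduced ((f ^^ n) (g gen1)) ((f ^^ n) (g gen2))" for n
  proof -
    obtain g where g: "nielsen g"
      "(f ^^ n) (g gen2) = 0 \<or> nielsen_reduced ((f ^^ n) (g gen1)) ((f ^^ n) (g gen2))"
      using nielsen_reduction[OF hom] by blast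
    have "(f ^^ n) (g gen2) \<noteq> 0"
    proof
      assume "(f ^^ n) (g gen2) = 0"
      then have "(f ^^ n) (g gen2) = (f ^^ n) (g 0)"
        using aut_nielsen[OF g(1)] by (simp add: autD grp_hom_zero hom)
      then have "gen2 = 0"
        using injn autD(3)[OF aut_nielsen[OF g(1)]] by (simp add: inj_eq)
      then show False using len_letter[of "(True, False)"] by (simp add: gen2_def)
    qed
    then show ?thesis using g by blast
  qed
  then obtain g where g: "\<And>n. nielsen (g n)"
    "\<And>n. nielsen_reduced ((f ^^ n) (g n gen1)) ((f ^^ n) (g n gen2))"
    by metis
  note ga = aut_nielsen[OF g(1)]
  \<comment> \<open>\<open>p n\<close> and \<open>q n\<close> form a Nielsen reduced basis of the
    image of \<open>f ^^ n\<close>, and \<open>v n\<close> spells u in it because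
    \<open>f ^^ n\<close> fixes u.\<close>
  define p where "p n = (f ^^ n) (g n gen1)" for n
  define q where "q n = (f ^^ n) (g n gen2)" for n
  define v where "v n = inv_into UNIV (g n) u" for n
  have ext: "ext (p n) (q n) = (f ^^ n) \<circ> g n" for n
    using grp_hom_eq_ext[OF grp_hom_comp[OF hom[of n] autD(1)[OF ga[of n]]]]
    by (simp add: p_def q_def)
  have ext_v: "ext (p n) (q n) (v n) = u" for n
    unfolding ext v_def by (simp add: aut_inv_simps[OF ga] fixn)
  have "\<exists>n c. \<forall>a \<in> set (Rep_free2 (v n)). fst a = c"
  proof (rule ccontr)
    assume *: "\<not> ?thesis"
    have bound: "len (p n) \<le> len u \<and> len (q n) \<le> len u" for n
    proof -
      from * obtain a b where "a \<in> set (Rep_free2 (v n))" "fst a"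
        "b \<in> set (Rep_free2 (v n))" "\<not> fst b" by (metis (full_types))
      then show ?thesis
        using nielsen_reduced_len_le[of "p n" "q n" a "v n"] nielsen_reduced_len_le[of "p n" "q n" b "v n"]
          g(2)[of n, folded p_def q_def]
        by (auto simp: ext_v len_letter_val)
    qed
    have "finite (range (\<lambda>n. (p n, q n)))"
      by (rule finite_subset[of _ "{w. len w \<le> len u} \<times> {w. len w \<le> len u}"])
         (use bound in \<open>auto simp: finite_len_le\<close>)
    then have "\<not> inj (\<lambda>n. (p n, q n))" using finite_imageD infinite_UNIV_nat by blast
    then obtain i j where ij: "i < j" "p i = p j" "q i = q j"
      unfolding inj_def by (metis linorder_neqE_nat prod.inject)
    \<comment> \<open>Equal pairs of basis elements give equal images. Cancelling the injective
      \<open>f ^^ i\<close> then makes \<open>f ^^ (j - i)\<close> surjective.\<close>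
    have range: "range ((f ^^ n) \<circ> g n) = range (f ^^ n)" for n
      using autD(4)[OF ga[of n]] by (metis image_comp)
    have "range (f ^^ i) = range (f ^^ j)"
      using range[of i] range[of j] ext[of i] ext[of j] ij by metis
    moreover have "f ^^ j = (f ^^ i) \<circ> (f ^^ (j - i))"
      using ij(1) by (simp flip: funpow_add)
    ultimately have "(f ^^ i) ` UNIV = (f ^^ i) ` range (f ^^ (j - i))"
      by (simp add: image_comp)
    then have "range (f ^^ (j - i)) = UNIV" using injn[of i] by (simp add: inj_image_eq_iff)
    moreover obtain k where "j - i = Suc k" using ij(1) by (metis Suc_diff_Suc)
    moreover have "range (f ^^ Suc k) \<subseteq> range f" by auto
    ultimately have "surj f" by (metis top.extremum_uniqueI)
    then show False using assms(3) by simp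
  qed
  \<comment> \<open>Only one generator occurs in \<open>v n\<close>, so \<open>v n\<close> is a
    power of a letter and u is the same power of a primitive element.\<close>
  then obtain n c where "\<And>a. a \<in> set (Rep_free2 (v n)) \<Longrightarrow> fst a = c" by blast
  then obtain k s where "Rep_free2 (v n) = replicate k (c, s)"
    using reduced_same_generator[OF reduced_Rep] by metis
  then have "v n = npow k (letter (c, s))"
    by (simp add: Rep_free2_inject[symmetric] Rep_npow_letter)
  then have "u = npow k (g n (letter (c, s)))"
    using aut_inv_simps(1)[OF ga, of n u] by (simp add: v_def grp_hom_npow[OF autD(1)[OF ga]])
  moreover obtain h where "aut h" "letter (c, s) = h gen1" using letter_eq_aut_gen1 by blast
  moreover have "k > 0" using calculation(1) assms(5) by (cases k) auto
  ultimately show ?thesis using that[of "g n \<circ> h" k] aut_comp[OF ga] by simp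
qed

text \<open>The endomorphism fixing \<open>gen1\<close> and sending \<open>gen2\<close> to z
  identifies two different k-th powers. Being non-injective, it has cyclic image, so
  \<open>gen1\<close> and z are powers of one element r; comparing exponent sums makes the exponents
  equal.\<close>

lemma npow_gen1_root:
  assumes "k > 0" "npow k z = npow k gen1" shows "z = gen1"
proof -
  define f where "f = ext gen1 z"
  obtain g where g: "nielsen g" "f (g gen2) = 0 \<or> nielsen_reduced (f (g gen1)) (f (g gen2))"
    using nielsen_reduction[OF grp_hom_ext] unfolding f_def by blast
  note ga = aut_nielsen[OF g(1)]
  have hom: "grp_hom (f \<circ> g)" by (simp add: f_def grp_hom_comp grp_hom_ext autD(1)[OF ga])
  have "f (npow k gen1) = f (npow k gen2)"
    using assms(2) by (simp add: f_def grp_hom_npow[OF grp_hom_ext])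
  then have eq: "(f \<circ> g) (inv_into UNIV g (npow k gen1)) = (f \<circ> g) (inv_into UNIV g (npow k gen2))"
    by (simp add: aut_inv_simps[OF ga])
  show ?thesis
    using g(2)
  proof
    assume "nielsen_reduced (f (g gen1)) (f (g gen2))"
    then have "inj (f \<circ> g)" using inj_ext_nielsen_reduced grp_hom_eq_ext[OF hom] by simp
    then have "g (inv_into UNIV g (npow k gen1)) = g (inv_into UNIV g (npow k gen2))"
      using eq by (metis injD)
    then have "npow k gen1 = npow k gen2" by (simp add: aut_inv_simps[OF ga])
    then have "exp1 (npow k gen1) = exp1 (npow k gen2)" by simp
    then show ?thesis using assms(1) by (simp add: grp_hom_npow grp_hom_exp npow_int)
  next
    assume "f (g gen2) = 0"
    then have pow: "f w = zpow (exp1 (inv_into UNIV g w)) (f (g gen1))" for w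
      using grp_hom_gen2_zero[OF hom, of "inv_into UNIV g w"] by (simp add: aut_inv_simps[OF ga])
    define r where "r = f (g gen1)"
    obtain i j where ij: "gen1 = zpow i r" "z = zpow j r"
      using pow[of gen1] pow[of gen2] unfolding f_def r_def[unfolded f_def, symmetric] by simp
    have "exp1 (npow k z) = exp1 (npow k gen1)" using assms(2) by simp
    then have "exp1 z = 1" using assms(1) by (simp add: grp_hom_npow grp_hom_exp npow_int)
    moreover have "exp1 (zpow n r) = n * exp1 r" for n
      by (simp add: grp_hom_zpow grp_hom_exp zpow_int)
    then have "1 = i * exp1 r" "exp1 z = j * exp1 r"
      using ij exp_gen(1) by metis+
    ultimately have "i * exp1 r = j * exp1 r" "exp1 r \<noteq> 0" by auto
    then have "i = j" by simp
    then show ?thesis using ij by simp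
  qed
qed

text \<open>The k-th power of any primitive element lies in the orbit of u, so its image is a k-th
  power of a primitive element. Uniqueness of roots carries this down to the elements
  themselves.\<close>

lemma preserves_orbit_root:
  assumes "grp_hom f" "preserves_orbit f u" "aut g" "k > 0" "u = npow k (g gen1)"
  shows "preserves_orbit f gen1"
  unfolding preserves_orbit_def
proof (intro allI impI)
  fix h assume h: "aut h"
  define h0 where "h0 = h \<circ> inv_into UNIV g"
  have h0: "aut h0" using aut_comp[OF h aut_inv[OF assms(3)]] by (simp add: h0_def)
  obtain h1 where h1: "aut h1" "f (h0 u) = h1 u"
    using assms(2) h0 unfolding preserves_orbit_def by blast
  define e where "e = h1 \<circ> g"
  have e: "aut e" using aut_comp[OF h1(1) assms(3)] by (simp add: e_def)
  have "npow k (f (h gen1)) = f (h0 u)"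
    by (simp add: assms(5) grp_hom_npow[OF autD(1)[OF h0]] grp_hom_npow[OF assms(1)])
       (simp add: h0_def aut_inv_simps[OF assms(3)])
  also have "\<dots> = npow k (e gen1)"
    unfolding h1(2) by (simp add: assms(5) grp_hom_npow[OF autD(1)[OF h1(1)]] e_def)
  finally have "npow k (inv_into UNIV e (f (h gen1))) = npow k gen1"
    using grp_hom_npow[OF autD(1)[OF aut_inv[OF e]], of k] aut_inv_simps(2)[OF e] by metis
  then have "inv_into UNIV e (f (h gen1)) = gen1" using npow_gen1_root assms(4) by blast
  then have "f (h gen1) = e gen1" using aut_inv_simps(1)[OF e] by metis
  then show "\<exists>h'. aut h' \<and> f (h gen1) = h' gen1" using e by blast
qed

section \<open>Primitive elements\<close>

definition lam :: "free2 \<Rightarrow> free2" where "lam = ext gen1 (gen2 + gen1)"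

text \<open>Images of the generators under the monoid spanned by two positive substitutions. Up to
  sign changes and conjugation these are all primitive elements, by
  \<open>conj_pos_prim_aut\<close>.\<close>

inductive pos_prim :: "free2 \<Rightarrow> bool" where
  pos_prim_gen1: "pos_prim gen1"
| pos_prim_gen2: "pos_prim gen2"
| pos_prim_nu: "pos_prim w \<Longrightarrow> pos_prim (nu w)"
| pos_prim_lam: "pos_prim w \<Longrightarrow> pos_prim (lam w)"

definition sign_change :: "bool \<Rightarrow> bool \<Rightarrow> free2 \<Rightarrow> free2" where
  "sign_change s t = ext (if s then - gen1 else gen1) (if t then - gen2 else gen2)"

definition conj_pos_prim :: "free2 \<Rightarrow> bool" where
  "conj_pos_prim w \<longleftrightarrow> (\<exists>g s t w'. pos_prim w' \<and> w = g + sign_change s t w' - g)"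

lemma conj_pos_primI: "pos_prim w \<Longrightarrow> conj_pos_prim (g + sign_change s t w - g)"
  unfolding conj_pos_prim_def by blast

lemma conj_pos_prim_sign_change_pos: "pos_prim w \<Longrightarrow> conj_pos_prim (sign_change s t w)"
  using conj_pos_primI[of w 0 s t] by simp

lemma sign_change_FF: "sign_change False False w = w"
  using grp_hom_eqI[OF grp_hom_ext grp_hom_id, of gen1 gen2] by (simp add: sign_change_def fun_eq_iff)

lemma conj_pos_prim_pos: "pos_prim w \<Longrightarrow> conj_pos_prim w"
  using conj_pos_prim_sign_change_pos[of w False False] by (simp add: sign_change_FF)

lemma conj_pos_prim_conj:
  assumes "conj_pos_prim w" shows "conj_pos_prim (h + w - h)"
proof -
  obtain g s t w' where *: "pos_prim w'" "w = g + sign_change s t w' - g"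
    using assms unfolding conj_pos_prim_def by blast
  have "h + w - h = (h + g) + sign_change s t w' - (h + g)"
    unfolding *(2) by (simp only: diff_conv_add_uminus minus_add add.assoc)
  then show ?thesis using conj_pos_primI[OF *(1)] by simp
qed

lemma grp_hom_conj:
  assumes "grp_hom f" shows "grp_hom (\<lambda>w. g + f w - g)"
  unfolding grp_hom_def grp_hom_plus[OF assms]
  by (simp only: diff_conv_add_uminus add.assoc minus_add_cancel simp_thms)

lemma grp_hom_conj_eqI:
  assumes "grp_hom f" "grp_hom f'" "f gen1 = g + f' gen1 - g" "f gen2 = g + f' gen2 - g"
  shows "f w = g + f' w - g"
  using grp_hom_eqI[OF assms(1) grp_hom_conj[OF assms(2)] assms(3,4)] by (rule fun_cong)

lemma grp_hom_maps:
  "grp_hom nu" "grp_hom lam" "grp_hom swap_gens" "grp_hom inv_gen1" "grp_hom (sign_change s t)"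
  by (simp_all add: nu_def lam_def swap_gens_def inv_gen1_def sign_change_def grp_hom_ext)

lemma grp_hom_fun_eqI:
  "grp_hom f \<Longrightarrow> grp_hom g \<Longrightarrow> f gen1 = g gen1 \<Longrightarrow> f gen2 = g gen2 \<Longrightarrow> f w = g w"
  using grp_hom_eqI by metis

lemma swap_swap: "swap_gens (swap_gens w) = w"
  using grp_hom_fun_eqI[OF grp_hom_comp[OF grp_hom_maps(3) grp_hom_maps(3)] grp_hom_id]
  by (simp add: swap_gens_def)

lemma swap_nu: "swap_gens (nu w) = lam (swap_gens w)"
  using grp_hom_fun_eqI[OF grp_hom_comp[OF grp_hom_maps(3) grp_hom_maps(1)]
      grp_hom_comp[OF grp_hom_maps(2) grp_hom_maps(3)]]
  by (simp add: nu_def lam_def swap_gens_def ext_simps)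

lemma swap_lam: "swap_gens (lam w) = nu (swap_gens w)"
  using swap_nu[of "swap_gens w"] by (metis swap_swap)

lemma pos_prim_swap: "pos_prim w \<Longrightarrow> pos_prim (swap_gens w)"
proof (induction rule: pos_prim.induct)
  case pos_prim_gen1
  then show ?case by (simp add: swap_gens_def pos_prim.intros)
next
  case pos_prim_gen2
  then show ?case by (simp add: swap_gens_def pos_prim.intros)
qed (simp_all add: swap_nu swap_lam pos_prim.intros)

lemma swap_sign_change: "swap_gens (sign_change s t w) = sign_change t s (swap_gens w)"
  using grp_hom_fun_eqI[OF grp_hom_comp[OF grp_hom_maps(3) grp_hom_maps(5)]
      grp_hom_comp[OF grp_hom_maps(5) grp_hom_maps(3)]]
  by (simp add: swap_gens_def sign_change_def ext_simps)

lemma inv_sign_change: "inv_gen1 (sign_change s t w) = sign_change (\<not> s) t w"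
  using grp_hom_fun_eqI[OF grp_hom_comp[OF grp_hom_maps(4) grp_hom_maps(5)] grp_hom_maps(5)]
  by (simp add: inv_gen1_def sign_change_def ext_simps)

lemma sign_change_sign_change:
  "sign_change s t (sign_change s' t' w) = sign_change (s \<noteq> s') (t \<noteq> t') w"
  using grp_hom_fun_eqI[OF grp_hom_comp[OF grp_hom_maps(5) grp_hom_maps(5)] grp_hom_maps(5)]
  by (simp add: sign_change_def ext_simps)

lemma conj_pos_prim_sign_change:
  assumes "conj_pos_prim w" shows "conj_pos_prim (sign_change s t w)"
proof -
  obtain g s' t' w' where *: "pos_prim w'" "w = g + sign_change s' t' w' - g"
    using assms unfolding conj_pos_prim_def by blast
  show ?thesis
    unfolding *(2) grp_hom_simps[OF grp_hom_maps(5)] sign_change_sign_change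
    by (rule conj_pos_primI[OF *(1)])
qed

text \<open>With mixed signs \<open>nu\<close> can create cancellation, so the last substitution
  that built w matters. A last \<open>nu\<close> is undone; a last \<open>lam\<close> leaves, up to
  conjugation by \<open>gen2\<close>, \<open>lam\<close> of a swapped positive word.\<close>

lemma nu_sign_change_FT:
  assumes "pos_prim w" shows "conj_pos_prim (nu (sign_change False True w))"
  using assms
proof cases
  case pos_prim_gen1
  then show ?thesis
    using conj_pos_prim_pos[OF pos_prim_nu[OF pos_prim.pos_prim_gen1]] by (simp add: sign_change_def)
next
  case pos_prim_gen2
  then show ?thesis
    using conj_pos_prim_sign_change_pos[OF pos_prim.pos_prim_gen2, of False True]
    by (simp add: sign_change_def nu_def ext_simps)
next
  case (pos_prim_nu v)
  have "nu (sign_change False True (nu v)) = sign_change False True v"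
    using grp_hom_fun_eqI[OF grp_hom_comp[OF grp_hom_maps(1) grp_hom_comp[OF grp_hom_maps(5)
      grp_hom_maps(1)]] grp_hom_maps(5), of False True False True]
    by (simp add: sign_change_def nu_def ext_simps)
  then show ?thesis using pos_prim_nu conj_pos_prim_sign_change_pos by simp
next
  case (pos_prim_lam v)
  have "nu (sign_change False True (lam v)) = - gen2 + lam (swap_gens v) - - gen2"
    using grp_hom_conj_eqI[OF grp_hom_comp[OF grp_hom_maps(1) grp_hom_comp[OF grp_hom_maps(5)
      grp_hom_maps(2)]] grp_hom_comp[OF grp_hom_maps(2) grp_hom_maps(3)], of False True "- gen2"]
    by (simp add: sign_change_def nu_def lam_def swap_gens_def ext_simps add.assoc[symmetric])
  then show ?thesis
    using pos_prim_lam conj_pos_prim_conj conj_pos_prim_pos pos_prim.pos_prim_lam pos_prim_swap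
    by metis
qed

text \<open>Changing both signs commutes with \<open>nu\<close> up to conjugation. This also reduces
  a sign change of \<open>gen1\<close> alone to one of \<open>gen2\<close> alone.\<close>

lemma nu_sign_change_TT: "nu (sign_change True True w) = - gen2 + sign_change True True (nu w) - - gen2"
  using grp_hom_conj_eqI[OF grp_hom_comp[OF grp_hom_maps(1) grp_hom_maps(5)[of True True]]
      grp_hom_comp[OF grp_hom_maps(5)[of True True] grp_hom_maps(1)], of "- gen2"]
  by (simp add: sign_change_def nu_def ext_simps minus_add add.assoc
      del: add_uminus_conv_diff uminus_add_conv_diff)

lemma conj_pos_prim_nu_sign_change:
  assumes "pos_prim w" shows "conj_pos_prim (nu (sign_change s t w))"
proof -
  note FT = nu_sign_change_FT[OF assms]
  have "sign_change True False w = sign_change True True (sign_change False True w)"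
    by (simp add: sign_change_sign_change)
  then have TF: "conj_pos_prim (nu (sign_change True False w))"
    using nu_sign_change_TT[of "sign_change False True w"]
      conj_pos_prim_conj[OF conj_pos_prim_sign_change[OF FT]] by metis
  have TT: "conj_pos_prim (nu (sign_change True True w))"
    unfolding nu_sign_change_TT
    by (intro conj_pos_prim_conj conj_pos_prim_sign_change conj_pos_prim_pos pos_prim_nu assms)
  have FF: "conj_pos_prim (nu (sign_change False False w))"
    using conj_pos_prim_pos[OF pos_prim_nu[OF assms]] by (simp add: sign_change_FF)
  show ?thesis using FT TF TT FF by (cases s; cases t) simp_all
qed

text \<open>The generator on the right acts first, so it suffices to treat each of the three
  generators; \<open>nu\<close> is the substantial one.\<close>

lemma conj_pos_prim_nielsen:
  assumes "nielsen f" "conj_pos_prim w" shows "conj_pos_prim (f w)"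
  using assms
proof (induction arbitrary: w)
  case (nielsen_nu f)
  from nielsen_nu.prems obtain g s t w' where *: "pos_prim w'" "w = g + sign_change s t w' - g"
    unfolding conj_pos_prim_def by blast
  have "conj_pos_prim (nu w)"
    unfolding *(2) grp_hom_simps[OF grp_hom_maps(1)]
    by (intro conj_pos_prim_conj conj_pos_prim_nu_sign_change *(1))
  then show ?case using nielsen_nu.IH by simp
next
  case (nielsen_swap f)
  from nielsen_swap.prems obtain g s t w' where *: "pos_prim w'" "w = g + sign_change s t w' - g"
    unfolding conj_pos_prim_def by blast
  have "conj_pos_prim (swap_gens w)"
    unfolding *(2) grp_hom_simps[OF grp_hom_maps(3)] swap_sign_change
    by (intro conj_pos_primI pos_prim_swap *(1))
  then show ?case using nielsen_swap.IH by simp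
next
  case (nielsen_inv f)
  from nielsen_inv.prems obtain g s t w' where *: "pos_prim w'" "w = g + sign_change s t w' - g"
    unfolding conj_pos_prim_def by blast
  have "conj_pos_prim (inv_gen1 w)"
    unfolding *(2) grp_hom_simps[OF grp_hom_maps(4)] inv_sign_change
    by (intro conj_pos_primI *(1))
  then show ?case using nielsen_inv.IH by simp
qed simp

lemma conj_pos_prim_letter: "conj_pos_prim (letter a)"
proof -
  have "letter (g, s) = (if g then sign_change False s gen2 else sign_change s False gen1)" for g s
    by (simp add: letter_eq_letter_val letter_val_def sign_change_def)
  then show ?thesis
    using conj_pos_prim_sign_change_pos pos_prim.intros(1,2) by (cases a) (simp split: if_splits)
qed

lemma len_one_eq_letter:
  assumes "len w = 1" obtains a where "w = letter a"
proof -
  obtain a where "Rep_free2 w = [a]" using assms by (auto simp: len_def length_Suc_conv)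
  then show ?thesis using that by (metis Rep_free2_inject Rep_letter)
qed

lemma gen_not_commute: "gen1 + gen2 \<noteq> gen2 + gen1"
proof -
  have "Rep_free2 (gen1 + gen2) = [(False, False), (True, False)]"
    "Rep_free2 (gen2 + gen1) = [(True, False), (False, False)]"
    by (simp_all add: gen1_def gen2_def Rep_letter_plus Rep_letter act_def canceling_def)
  then show ?thesis by (metis list.inject prod.inject)
qed

lemma same_generator_commute:
  assumes "\<And>a. a \<in> set (Rep_free2 v) \<union> set (Rep_free2 w) \<Longrightarrow> fst a = c"
  shows "v + w = w + v"
proof -
  have "\<exists>i. x = zpow i (letter (c, False))" 
    if x: "\<And>a. a \<in> set (Rep_free2 x) \<Longrightarrow> fst a = c" for x
  proof -
    obtain k s where "Rep_free2 x = replicate k (c, s)"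
      using reduced_same_generator[OF reduced_Rep x] by blast
    then have "x = npow k (letter (c, s))"
      by (simp add: Rep_free2_inject[symmetric] Rep_npow_letter)
    moreover have "zpow (- int k) (letter (c, False)) = npow k (letter (c, True))"
    proof (induction k)
      case (Suc k)
      then show ?case
        using zpow_diff_one[of "- int k" "letter (c, False)"] letter_inv[of "(c, False)"] by simp
    qed simp
    moreover have "zpow (int k) (letter (c, False)) = npow k (letter (c, False))"
      by (simp add: zpow_def)
    ultimately show ?thesis by (cases s) metis+
  qed
  then obtain i j where ij: "v = zpow i (letter (c, False))" "w = zpow j (letter (c, False))"
    using assms by (metis UnCI)
  show ?thesis unfolding ij by (metis zpow_add add.commute)
qed

text \<open>If one element of a Nielsen reduced basis had length at least two, then both generators
  would lie in the cyclic group spanned by the other one.\<close>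

lemma conj_pos_prim_aut:
  assumes "aut f" shows "conj_pos_prim (f gen1)"
proof -
  \<comment> \<open>Reducing the inverse of f gives f as g after the inverse of e. Since e will turn
    out to permute the letters, \<open>f gen1\<close> is g of a letter.\<close>
  define h where "h = inv_into UNIV f"
  have h: "aut h" using aut_inv[OF assms] by (simp add: h_def)
  obtain g where g: "nielsen g" "h (g gen2) = 0 \<or> nielsen_reduced (h (g gen1)) (h (g gen2))"
    using nielsen_reduction[OF autD(1)[OF h]] by blast
  define e where "e = h \<circ> g"
  have e: "aut e" using aut_comp[OF h aut_nielsen[OF g(1)]] by (simp add: e_def)
  have fe: "f (e w) = g w" for w
    using aut_inv_simps(1)[OF assms] by (simp add: e_def h_def)
  have "e gen2 \<noteq> 0"
  proof
    assume "e gen2 = 0"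
    then have "e gen2 = e 0" by (simp add: grp_hom_zero[OF autD(1)[OF e]])
    then have "gen2 = 0" using autD(3)[OF e] by (simp add: inj_eq)
    then show False using len_letter[of "(True, False)"] by (simp add: gen2_def)
  qed
  then have nr: "nielsen_reduced (e gen1) (e gen2)" using g(2) by (simp add: e_def)
  have ext: "ext (e gen1) (e gen2) = e" using grp_hom_eq_ext[OF autD(1)[OF e]] by simp
  \<comment> \<open>\<open>v a\<close> spells the letter a in the reduced basis, so every basis
    element it uses has length at most one.\<close>
  define v where "v a = inv_into UNIV e (letter a)" for a
  have ev: "e (v a) = letter a" for a by (simp add: v_def aut_inv_simps[OF e])
  have short: "len (letter_val (e gen1) (e gen2) b) \<le> 1" if "b \<in> set (Rep_free2 (v a))" for a b
    using nielsen_reduced_len_le[OF nr that] by (simp add: ext ev)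
  have len: "len (letter_val (e gen1) (e gen2) c) = 1" for c
  proof (rule ccontr)
    assume "len (letter_val (e gen1) (e gen2) c) \<noteq> 1"
    then have "len (letter_val (e gen1) (e gen2) c) > 1"
      using nielsen_reduced_letter_val_nonzero[OF nr, of c] len_eq_0_iff by (metis less_one linorder_neqE_nat)
    then have "fst b = (\<not> fst c)" if "b \<in> set (Rep_free2 (v a))" for a b
      using short[OF that] by (auto simp: len_letter_val split: if_splits)
    then have "v (False, False) + v (True, False) = v (True, False) + v (False, False)"
      by (intro same_generator_commute[where c = "\<not> fst c"]) auto
    then have "e (v (False, False) + v (True, False)) = e (v (True, False) + v (False, False))"
      by simp
    then show False
      using gen_not_commute by (simp add: grp_hom_plus[OF autD(1)[OF e]] ev gen1_def gen2_def)
  qed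
  obtain a where a: "e gen1 = letter a" using len[of "(False, False)"] len_one_eq_letter by auto
  obtain b where b: "e gen2 = letter b" using len[of "(True, False)"] len_one_eq_letter by auto
  have "fst a \<noteq> fst b"
  proof
    assume "fst a = fst b"
    then have "letter a + letter b = letter b + letter a"
      by (intro same_generator_commute[where c = "fst b"]) (auto simp: Rep_letter)
    then have "e (gen1 + gen2) = e (gen2 + gen1)"
      by (simp add: grp_hom_plus[OF autD(1)[OF e]] a b)
    then show False using gen_not_commute autD(3)[OF e] by (simp add: inj_eq)
  qed
  then obtain c where "letter_val (e gen1) (e gen2) c = gen1"
  proof -
    assume *: "\<And>c. letter_val (e gen1) (e gen2) c = gen1 \<Longrightarrow> thesis"
    show thesis
    proof (cases "fst a")
      case False
      then have "letter_val (e gen1) (e gen2) (False, snd a) = gen1"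
        using a by (cases a) (auto simp: letter_val_def gen1_def letter_inv[symmetric] Let_def)
      then show thesis by (rule *)
    next
      case True
      then have "letter_val (e gen1) (e gen2) (True, snd b) = gen1"
        using \<open>fst a \<noteq> fst b\<close> b by (cases b) (auto simp: letter_val_def gen1_def letter_inv[symmetric] Let_def)
      then show thesis by (rule *)
    qed
  qed
  then have "e (letter c) = gen1" by (simp add: grp_hom_letter[OF autD(1)[OF e]])
  then have "f gen1 = g (letter c)" using fe[of "letter c"] by simp
  then show ?thesis using conj_pos_prim_nielsen[OF g(1) conj_pos_prim_letter] by simp
qed

section \<open>Cyclic length of primitive elements\<close>

inductive positive :: "free2 \<Rightarrow> bool" where
  positive_zero: "positive 0"
| positive_gen1: "positive w \<Longrightarrow> positive (gen1 + w)"
| positive_gen2: "positive w \<Longrightarrow> positive (gen2 + w)"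

lemma positive_plus: "positive v \<Longrightarrow> positive w \<Longrightarrow> positive (v + w)"
  by (induction rule: positive.induct) (simp_all add: add.assoc positive.intros)

lemma positive_gens: "positive gen1" "positive gen2"
  using positive_gen1[OF positive_zero] positive_gen2[OF positive_zero] by simp_all

lemma positive_ext: "positive w \<Longrightarrow> positive x \<Longrightarrow> positive y \<Longrightarrow> positive (ext x y w)"
  by (induction rule: positive.induct) (simp_all add: ext_simps positive.intros positive_plus)

lemma pos_prim_positive: "pos_prim w \<Longrightarrow> positive w"
  by (induction rule: pos_prim.induct)
     (simp_all add: nu_def lam_def positive_gens positive_plus positive_ext)

lemma len_gens [simp]: "len gen1 = 1" "len gen2 = 1"
  by (simp_all add: gen1_def gen2_def)

lemma positive_len:
  assumes "positive w"
  shows "int (len (sign_change s t w)) \<le> exp1 w + exp2 w" "0 \<le> exp1 w" "0 \<le> exp2 w"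
  using assms
proof (induction rule: positive.induct)
  case (positive_gen1 w)
  {
    case 1
    show ?case
      using len_plus_le[of "sign_change s t gen1" "sign_change s t w"] positive_gen1.IH(1)
      by (simp add: grp_hom_simps[OF grp_hom_maps(5)] exp_simps) (simp add: sign_change_def split: if_splits)
  }
  case 2 show ?case using positive_gen1.IH(2) by (simp add: exp_simps)
  case 3 show ?case using positive_gen1.IH(3) by (simp add: exp_simps)
next
  case (positive_gen2 w)
  {
    case 1
    show ?case
      using len_plus_le[of "sign_change s t gen2" "sign_change s t w"] positive_gen2.IH(1)
      by (simp add: grp_hom_simps[OF grp_hom_maps(5)] exp_simps) (simp add: sign_change_def split: if_splits)
  }
  case 2 show ?case using positive_gen2.IH(2) by (simp add: exp_simps)
  case 3 show ?case using positive_gen2.IH(3) by (simp add: exp_simps)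
qed (simp_all add: exp_simps grp_hom_simps[OF grp_hom_maps(5)])

lemma exp_conj: "exp1 (g + w - g) = exp1 w" "exp2 (g + w - g) = exp2 w"
  by (simp_all add: exp_simps)

text \<open>A positive word is no longer than the sum of its exponent sums. Conjugation preserves
  these sums and sign changes preserve their absolute values.\<close>

lemma primitive_conj_short:
  assumes "aut f"
  obtains g w where "f gen1 = g + w - g" "int (len w) \<le> \<bar>exp1 (f gen1)\<bar> + \<bar>exp2 (f gen1)\<bar>"
proof -
  obtain g s t w where *: "pos_prim w" "f gen1 = g + sign_change s t w - g"
    using conj_pos_prim_aut[OF assms] unfolding conj_pos_prim_def by blast
  have "\<bar>exp1 (f gen1)\<bar> = \<bar>exp1 w\<bar>" "\<bar>exp2 (f gen1)\<bar> = \<bar>exp2 w\<bar>"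
    unfolding *(2) exp_conj by (auto simp: sign_change_def exp_ext exp_simps)
  then show ?thesis
    using that[OF *(2)] positive_len[OF pos_prim_positive[OF *(1)]] by simp
qed

text \<open>The hypothesis is the encoding of "cyclically reduced" used here and below.\<close>

lemma Rep_npow_cyc_reduced:
  assumes "reduced (Rep_free2 w @ Rep_free2 w)"
  shows "Rep_free2 (npow n w) = concat (replicate n (Rep_free2 w))"
proof (induction n)
  case (Suc n)
  have "reduced (Rep_free2 w @ Rep_free2 (npow n w))"
    unfolding reduced_append Suc using assms Suc reduced_Rep[of "npow n w"]
    by (cases n) (auto simp: reduced_append)
  then show ?case using Rep_plus_reduced Suc by simp
qed (simp add: Rep_zero)

lemma len_npow_le: "len (npow n w) \<le> n * len w"
proof (induction n)
  case (Suc n)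
  then show ?case using len_plus_le[of w "npow n w"] by simp
qed simp

text \<open>Compare the lengths of the n-th powers of both sides as n tends to infinity.\<close>

lemma cyc_reduced_len_le_conj:
  assumes "reduced (Rep_free2 w @ Rep_free2 w)" "w = g + w' - g"
  shows "len w \<le> len w'"
proof (rule ccontr)
  assume "\<not> ?thesis"
  then have l: "Suc (len w') \<le> len w" by simp
  \<comment> \<open>Just large enough that one extra letter per factor outweighs the two copies of
    the conjugator.\<close>
  define n where "n = Suc (2 * len g)"
  have "len (npow n w) = n * len w"
    by (simp add: len_def Rep_npow_cyc_reduced[OF assms(1)] length_concat sum_list_replicate)
  moreover have "npow n w = g + npow n w' - g"
    unfolding assms(2) by (rule npow_conj)
  then have "len (npow n w) \<le> 2 * len g + n * len w'"
    using len_plus_le[of "g + npow n w'" "- g"] len_plus_le[of g "npow n w'"] len_npow_le[of n w']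
    by simp
  moreover have "n * Suc (len w') \<le> n * len w" using l by (rule mult_le_mono2)
  ultimately show False by (simp add: n_def)
qed

lemma abs_exp2_le: "\<bar>exp2 w\<bar> \<le> int (length (filter fst (Rep_free2 w)))"
proof (induction w rule: free2_induct)
  case (letter_plus a w)
  then show ?case
    by (cases a) (auto simp: exp_simps grp_hom_letter[OF grp_hom_exp(2)] letter_val_def)
qed (simp add: exp_simps Rep_zero)

section \<open>Endomorphisms preserving primitivity\<close>

lemma preserves_primitive_fix_gen1:
  assumes "grp_hom f" "f gen1 = gen1" "preserves_orbit f gen1"
    and ne: "Rep_free2 (f gen2) \<noteq> []"
    and hd: "fst (hd (Rep_free2 (f gen2)))" and last: "fst (last (Rep_free2 (f gen2)))"
  shows "aut f"
proof -
  define y where "y = f gen2"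
  \<comment> \<open>The sign s decides between x1^k y and x1^-k y. This word \<open>w\<close> is
    cyclically reduced because y starts and ends with letters of \<open>gen2\<close>, and it is the
    image of the primitive element \<open>h gen1\<close>. Hence its whole length obeys the bound on
    cyclic length.\<close>
  have bound: "int k + int (len y) \<le> \<bar>int k * e + exp1 y\<bar> + \<bar>exp2 y\<bar>"
    if k: "k > 0" and e: "e = (if s then - 1 else 1)" for k s e
  proof -
    define w where "w = npow k (letter (False, s)) + y"
    have "reduced (replicate k (False, s) @ Rep_free2 y)"
      using hd reduced_Rep[of "npow k (letter (False, s))"]
      by (auto simp: reduced_append y_def Rep_npow_letter)
    then have rep: "Rep_free2 w = replicate k (False, s) @ Rep_free2 y"
      unfolding w_def using Rep_plus_reduced[of "npow k (letter (False, s))" y] by (simp add: Rep_npow_letter)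
    have "inv_letter (last (Rep_free2 y)) \<noteq> (False, s)"
      using last by (auto simp: y_def inv_letter_def)
    then have cyc: "reduced (Rep_free2 w @ Rep_free2 w)"
      using ne k reduced_Rep[of w] unfolding reduced_append[of "Rep_free2 w"]
      by (auto simp: rep y_def hd_append)
    define h where "h = ext (npow k (letter (False, s)) + gen2) gen1"
    have fix_letter: "f (letter (False, s)) = letter (False, s)"
      using assms(2) by (simp add: grp_hom_letter[OF assms(1)] letter_eq_letter_val letter_val_def
          grp_hom_uminus[OF assms(1)])
    have "aut h" unfolding h_def
      by (rule autI[of _ "ext gen2 (- npow k (letter (True, s)) + gen1)"])
         (simp_all add: grp_hom_ext ext_simps grp_hom_npow[OF grp_hom_ext]
           letter_eq_letter_val letter_val_def)
    then obtain h' where h': "aut h'" "f (h gen1) = h' gen1"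
      using assms(3) unfolding preserves_orbit_def by blast
    have w: "h' gen1 = w"
      using h'(2) by (simp add: h_def w_def y_def grp_hom_simps[OF assms(1)]
          grp_hom_npow[OF assms(1)] fix_letter)
    obtain g w' where "w = g + w' - g" "int (len w') \<le> \<bar>exp1 w\<bar> + \<bar>exp2 w\<bar>"
      using primitive_conj_short[OF h'(1)] w by metis
    moreover have "len w \<le> len w'" using cyc_reduced_len_le_conj[OF cyc calculation(1)] .
    moreover have "len w = k + len y" by (simp add: len_def rep)
    moreover have "exp1 w = int k * e + exp1 y" "exp2 w = exp2 y"
      by (simp_all add: w_def exp_simps grp_hom_npow grp_hom_exp npow_int e
          grp_hom_letter[OF grp_hom_exp(1)] grp_hom_letter[OF grp_hom_exp(2)] letter_val_def)
    ultimately show ?thesis by linarith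
  qed
  \<comment> \<open>Since k exceeds the absolute value of \<open>exp1 y\<close>, the signs inside
    the absolute values are known, and adding the two bounds cancels both k and
    \<open>exp1 y\<close>.\<close>
  define k where "k = nat (\<bar>exp1 y\<bar> + 1)"
  have "k > 0" "int k = \<bar>exp1 y\<bar> + 1" by (simp_all add: k_def)
  then have "int (len y) \<le> \<bar>exp2 y\<bar>"
    using bound[of k 1 False] bound[of k "- 1" True] by simp
  then have "len y \<le> length (filter fst (Rep_free2 y))"
    using abs_exp2_le[of y] by linarith
  then have "filter fst (Rep_free2 y) = Rep_free2 y"
    using length_filter_less[of _ "Rep_free2 y" fst] by (metis filter_True len_def not_less)
  then have "fst a = True" if "a \<in> set (Rep_free2 y)" for a
    using that by (simp add: filter_id_conv)
  then obtain m s where "Rep_free2 y = replicate m (True, s)"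
    using reduced_same_generator[OF reduced_Rep] by metis
  then have y: "y = npow m (letter (True, s))"
    by (simp add: Rep_free2_inject[symmetric] Rep_npow_letter)
  \<comment> \<open>y is primitive as the image of \<open>gen2\<close>. Pulling it back to
    \<open>gen1\<close> shows that m divides the exponent sum 1.\<close>
  obtain h where h: "aut h" "f (swap_gens gen1) = h gen1"
    using assms(3) aut_nielsen_gens(2) unfolding preserves_orbit_def by blast
  then have "h gen1 = npow m (letter (True, s))" using y by (simp add: swap_gens_def y_def)
  then have "gen1 = npow m (inv_into UNIV h (letter (True, s)))"
    using aut_inv_simps(2)[OF h(1), of gen1] by (simp add: grp_hom_npow[OF autD(1)[OF aut_inv[OF h(1)]]])
  then have "exp1 gen1 = int m * exp1 (inv_into UNIV h (letter (True, s)))"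
    by (metis grp_hom_npow grp_hom_exp(1) npow_int)
  then have "int m dvd 1" by (metis dvd_triv_left exp_gen(1))
  then have "m = 1" by simp
  then have "f = ext gen1 (letter (True, s))"
    using grp_hom_eq_ext[OF assms(1)] assms(2) y by (simp add: y_def)
  moreover have "aut (ext gen1 (letter (True, s)))"
    by (rule autI[of _ "ext gen1 (letter (True, s))"])
       (simp_all add: grp_hom_ext ext_letter letter_eq_letter_val letter_val_def ext_simps)
  ultimately show ?thesis by simp
qed

section \<open>Endomorphisms preserving an orbit\<close>

lemma aut_cancel_right:
  assumes "aut (f \<circ> g)" "aut g" shows "aut f"
proof -
  have "f = (f \<circ> g) \<circ> inv_into UNIV g"
    using aut_inv_simps(1)[OF assms(2)] by (simp add: fun_eq_iff)
  then show ?thesis using aut_comp[OF assms(1) aut_inv[OF assms(2)]] by simp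
qed

lemma aut_cancel_left:
  assumes "aut (g \<circ> f)" "aut g" shows "aut f"
proof -
  have "f = inv_into UNIV g \<circ> (g \<circ> f)"
    using aut_inv_simps(2)[OF assms(2)] by (simp add: fun_eq_iff)
  then show ?thesis using aut_comp[OF aut_inv[OF assms(2)] assms(1)] by simp
qed

lemma preserves_orbit_comp_right: "preserves_orbit f u \<Longrightarrow> aut g \<Longrightarrow> preserves_orbit (f \<circ> g) u"
  unfolding preserves_orbit_def using aut_comp[of g] by (metis comp_apply)

lemma preserves_orbit_comp_left: "preserves_orbit f u \<Longrightarrow> aut g \<Longrightarrow> preserves_orbit (g \<circ> f) u"
  unfolding preserves_orbit_def using aut_comp[of g] by (metis comp_apply)

text \<open>Induction strips letters of \<open>gen1\<close> from either end of \<open>f gen2\<close>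
  by precomposing with automorphisms that fix \<open>gen1\<close>, until
  \<open>preserves_primitive_fix_gen1\<close> applies.\<close>

lemma aut_if_preserves_primitives_fix_gen1:
  assumes "grp_hom f" "f gen1 = gen1" "preserves_orbit f gen1"
  shows "aut f"
  using assms
proof (induction "len (f gen2)" arbitrary: f rule: less_induct)
  case less
  define y where "y = f gen2"
  have shorter: "aut f" if h: "aut h" "h gen1 = gen1" "len (f (h gen2)) < len y" for h
  proof -
    have "aut (f \<circ> h)"
    proof (rule less.hyps)
      show "len ((f \<circ> h) gen2) < len (f gen2)" using h(3) by (simp add: y_def)
      show "grp_hom (f \<circ> h)" using less.prems(1) autD(1)[OF h(1)] by (rule grp_hom_comp)
      show "(f \<circ> h) gen1 = gen1" by (simp add: h(2) less.prems(2))
      show "preserves_orbit (f \<circ> h) gen1" using less.prems(3) h(1) by (rule preserves_orbit_comp_right)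
    qed
    then show ?thesis using h(1) by (rule aut_cancel_right)
  qed
  have fixed: "g (letter (False, s)) = letter (False, s)" if "grp_hom g" "g gen1 = gen1" for g s
    using that by (simp add: grp_hom_letter letter_eq_letter_val letter_val_def grp_hom_uminus)
  have shift: "aut (ext gen1 (a + gen2 + b))"
    if "a = 0 \<or> a = letter (False, s)" "b = 0 \<or> b = letter (False, s)" for a b s
  proof (rule autI[of _ "ext gen1 (- a + gen2 - b)"])
    have "ext gen1 x a = a" "ext gen1 x b = b" for x
      using that fixed[OF grp_hom_ext] by (auto simp: ext_simps)
    then show "ext gen1 (a + gen2 + b) (ext gen1 (- a + gen2 - b) gen2) = gen2"
      "ext gen1 (- a + gen2 - b) (ext gen1 (a + gen2 + b) gen2) = gen2"
      by (simp_all add: ext_simps add.assoc)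
  qed (simp_all add: grp_hom_ext)
  have "Rep_free2 y \<noteq> []"
  proof
    assume "Rep_free2 y = []"
    then have "y = 0" by (simp add: Rep_free2_inject[symmetric] Rep_zero)
    obtain h where h: "aut h" "f (swap_gens gen1) = h gen1"
      using less.prems(3) aut_nielsen_gens(2) unfolding preserves_orbit_def by blast
    then have "h gen1 = h 0"
      using \<open>y = 0\<close> by (simp add: swap_gens_def y_def grp_hom_zero[OF autD(1)])
    then have "gen1 = 0" using autD(3)[OF h(1)] by (simp add: inj_eq)
    then show False using len_gens(1) by simp
  qed
  show ?case
  proof (cases "fst (hd (Rep_free2 y)) \<and> fst (last (Rep_free2 y))")
    case True
    then show ?thesis
      using preserves_primitive_fix_gen1[OF less.prems] \<open>Rep_free2 y \<noteq> []\<close> by (simp add: y_def)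
  next
    case False
    then consider "\<not> fst (hd (Rep_free2 y))" | "\<not> fst (last (Rep_free2 y))" by blast
    then show ?thesis
    proof cases
      case 1
      then obtain s v where "Rep_free2 y = (False, s) # v"
        using \<open>Rep_free2 y \<noteq> []\<close> by (cases "Rep_free2 y") auto
      then obtain y' where y': "y = letter (False, s) + y'" "Rep_free2 y' = v" by (rule Rep_ConsE)
      define h where "h = ext gen1 (letter (False, \<not> s) + gen2 + 0)"
      have "aut h" unfolding h_def by (rule shift) auto
      moreover have "f (h gen2) = letter (False, \<not> s) + y"
        by (simp add: h_def grp_hom_plus[OF less.prems(1)] fixed[OF less.prems(1,2)] y_def)
      then have "f (h gen2) = y'"
        using letter_inv[of "(False, s)"] by (simp add: y'(1))
      ultimately show ?thesis
        using shorter[of h] y' \<open>Rep_free2 y = _\<close> by (simp add: h_def len_def)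
    next
      case 2
      have "Rep_free2 (- y) = inv_letter (last (Rep_free2 y)) # inv_word (butlast (Rep_free2 y))"
        using \<open>Rep_free2 y \<noteq> []\<close> unfolding Rep_uminus inv_word_def
        by (cases "Rep_free2 y" rule: rev_cases) auto
      moreover obtain s where "inv_letter (last (Rep_free2 y)) = (False, s)"
        using 2 by (metis inv_letter_simps(3) prod.collapse)
      ultimately have r: "Rep_free2 (- y) = (False, s) # inv_word (butlast (Rep_free2 y))" by simp
      then obtain y' where y': "- y = letter (False, s) + y'" "Rep_free2 y' = inv_word (butlast (Rep_free2 y))"
        by (rule Rep_ConsE)
      define h where "h = ext gen1 (0 + gen2 + letter (False, s))"
      have "aut h" unfolding h_def by (rule shift) auto
      have "y = - (letter (False, s) + y')" using y'(1) by (metis minus_minus)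
      then have "y + letter (False, s) = - y'"
        by (simp add: minus_add add.assoc del: add_uminus_conv_diff)
      then have "f (h gen2) = - y'"
        using fixed[OF less.prems(1,2)]
        by (simp add: h_def grp_hom_plus[OF less.prems(1)] y_def)
      moreover have "len (- y') < len y"
        unfolding len_uminus[of y'] len_uminus[of y, symmetric] by (simp add: len_def r y'(2))
      ultimately show ?thesis
        using shorter[of h] \<open>aut h\<close> by (simp add: h_def)
    qed
  qed
qed

lemma aut_if_preserves_primitives:
  assumes "grp_hom f" "preserves_orbit f gen1" shows "aut f"
proof -
  obtain h where h: "aut h" "f gen1 = h gen1"
    using assms(2) aut_id unfolding preserves_orbit_def by (metis id_apply)
  define g where "g = inv_into UNIV h"
  have g: "aut g" using aut_inv[OF h(1)] by (simp add: g_def)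
  have "aut (g \<circ> f)"
  proof (rule aut_if_preserves_primitives_fix_gen1)
    show "grp_hom (g \<circ> f)" using autD(1)[OF g] assms(1) by (rule grp_hom_comp)
    show "(g \<circ> f) gen1 = gen1" by (simp add: h(2) g_def aut_inv_simps[OF h(1)])
    show "preserves_orbit (g \<circ> f) gen1" using assms(2) g by (rule preserves_orbit_comp_left)
  qed
  then show ?thesis using g by (rule aut_cancel_left)
qed

lemma aut_if_preserves_orbit:
  assumes "grp_hom f" "preserves_orbit f u" "u \<noteq> 0"
  shows "aut f"
proof -
  obtain g where g: "nielsen g" "f (g gen2) = 0 \<or> nielsen_reduced (f (g gen1)) (f (g gen2))"
    using nielsen_reduction[OF assms(1)] by blast
  note ga = aut_nielsen[OF g(1)]
  have "nielsen_reduced (f (g gen1)) (f (g gen2))"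
    using g(2) preserves_orbit_kernel[OF assms(1,2) ga] assms(3) by blast
  then have "inj (f \<circ> g)"
    using inj_ext_nielsen_reduced grp_hom_eq_ext[OF grp_hom_comp[OF assms(1) autD(1)[OF ga]]] by simp
  then have "inj ((f \<circ> g) \<circ> inv_into UNIV g)" using autD(3)[OF aut_inv[OF ga]] by (rule inj_compose)
  moreover have "(f \<circ> g) \<circ> inv_into UNIV g = f"
    using aut_inv_simps(1)[OF ga] by (simp add: fun_eq_iff)
  ultimately have inj: "inj f" by simp
  show ?thesis
  proof (rule ccontr)
    assume "\<not> aut f"
    then have nsurj: "\<not> surj f" using inj assms(1) by (simp add: aut_def bij_def)
    obtain h where h: "aut h" "f u = h u"
      using assms(2) aut_id unfolding preserves_orbit_def by (metis id_apply)
    \<comment> \<open>Undoing \<open>h\<close> turns f into a proper monomorphism fixing u. What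
      this yields about u is then used for f itself.\<close>
    define e where "e = inv_into UNIV h"
    have e: "aut e" using aut_inv[OF h(1)] by (simp add: e_def)
    obtain g k where "aut g" "k > 0" "u = npow k (g gen1)"
    proof (rule fixed_by_proper_mono[of "e \<circ> f" u])
      show "grp_hom (e \<circ> f)" using autD(1)[OF e] assms(1) by (rule grp_hom_comp)
      show "inj (e \<circ> f)" using autD(3)[OF e] inj by (rule inj_compose)
      show "(e \<circ> f) u = u" by (simp add: h(2) e_def aut_inv_simps[OF h(1)])
      show "\<not> surj (e \<circ> f)"
      proof
        assume "surj (e \<circ> f)"
        then have "surj (h \<circ> (e \<circ> f))" using autD(4)[OF h(1)] comp_surj by blast
        moreover have "h \<circ> (e \<circ> f) = f" by (simp add: e_def fun_eq_iff aut_inv_simps[OF h(1)])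
        ultimately show False using nsurj by simp
      qed
    qed (use assms(3) in auto)
    then have "preserves_orbit f gen1" using preserves_orbit_root[OF assms(1,2)] by blast
    then show False using aut_if_preserves_primitives assms(1) \<open>\<not> aut f\<close> by blast
  qed
qed

section \<open>Transfer to the group of reduced words\<close>

lemma carrier_F2: "carrier F2 = {w. reduced w}" and one_F2: "\<one>\<^bsub>F2\<^esub> = []"
  and mult_F2: "v \<otimes>\<^bsub>F2\<^esub> w = reduce (v @ w)"
  by (simp_all add: F2_def)

definition lift_map :: "(letter2 list \<Rightarrow> letter2 list) \<Rightarrow> free2 \<Rightarrow> free2" where
  "lift_map f w = Abs_free2 (f (Rep_free2 w))"

definition drop_map :: "(free2 \<Rightarrow> free2) \<Rightarrow> letter2 list \<Rightarrow> letter2 list" where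
  "drop_map f w = Rep_free2 (f (Abs_free2 w))"

lemma Rep_lift_map: "f \<in> hom F2 F2 \<Longrightarrow> Rep_free2 (lift_map f w) = f (Rep_free2 w)"
  unfolding lift_map_def by (rule Rep_Abs) (auto simp: hom_def carrier_F2)

lemma grp_hom_lift_map: "f \<in> hom F2 F2 \<Longrightarrow> grp_hom (lift_map f)"
  unfolding grp_hom_def Rep_free2_inject[symmetric] Rep_plus Rep_lift_map
  by (simp add: Rep_plus hom_def carrier_F2 mult_F2)

lemma bij_betw_Rep: "bij_betw Rep_free2 UNIV (carrier F2)"
  by (rule bij_betwI[of _ _ _ Abs_free2]) (auto simp: carrier_F2 Rep_free2_inverse)

lemma bij_lift_map_iff:
  assumes "f \<in> hom F2 F2" shows "bij (lift_map f) \<longleftrightarrow> bij_betw f (carrier F2) (carrier F2)"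
proof -
  have eq: "Rep_free2 \<circ> lift_map f = f \<circ> Rep_free2"
    by (simp add: fun_eq_iff Rep_lift_map[OF assms])
  have "bij (lift_map f) \<longleftrightarrow> bij_betw (Rep_free2 \<circ> lift_map f) UNIV (carrier F2)"
    by (rule bij_betw_comp_iff2[OF bij_betw_Rep]) simp
  also have "\<dots> \<longleftrightarrow> bij_betw f (carrier F2) (carrier F2)"
    unfolding eq by (rule bij_betw_comp_iff[OF bij_betw_Rep, symmetric])
  finally show ?thesis .
qed

text \<open>Both sides depend only on the values of f at reduced words. The condition
  \<open>hom\<close> stays on the right because \<open>lift_map\<close> does not reveal whether f
  keeps words reduced.\<close>

lemma iso_F2_iff: "f \<in> iso F2 F2 \<longleftrightarrow> f \<in> hom F2 F2 \<and> aut (lift_map f)"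
  using bij_lift_map_iff grp_hom_lift_map by (auto simp: iso_def aut_def)

lemma drop_map_iso:
  assumes "aut f" shows "drop_map f \<in> iso F2 F2"
proof -
  have "drop_map f \<in> hom F2 F2"
  proof (rule homI)
    fix v w assume "v \<in> carrier F2" "w \<in> carrier F2"
    then have "Abs_free2 (reduce (v @ w)) = Abs_free2 v + Abs_free2 w"
      by (simp add: carrier_F2 plus_free2_def)
    then show "drop_map f (v \<otimes>\<^bsub>F2\<^esub> w) = drop_map f v \<otimes>\<^bsub>F2\<^esub> drop_map f w"
      by (simp add: mult_F2 drop_map_def grp_hom_plus[OF autD(1)[OF assms]] Rep_plus)
  qed (simp add: drop_map_def carrier_F2)
  moreover have "lift_map (drop_map f) = f"
    by (simp add: fun_eq_iff lift_map_def drop_map_def Rep_free2_inverse)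
  ultimately show ?thesis using assms by (simp add: iso_F2_iff)
qed

theorem theorem1p1:
  fixes u :: "letter2 list" and \<phi> :: "letter2 list \<Rightarrow> letter2 list"
  assumes "u \<in> carrier F2" and "u \<noteq> \<one>\<^bsub>F2\<^esub>"
    and "\<phi> \<in> hom F2 F2"
    and "\<phi> ` aut_orbit u \<subseteq> aut_orbit u"
  shows "\<phi> \<in> iso F2 F2"
proof -
  define v where "v = Abs_free2 u"
  have Rep_v: "Rep_free2 v = u" using assms(1) by (simp add: v_def carrier_F2)
  have "preserves_orbit (lift_map \<phi>) v"
    unfolding preserves_orbit_def
  proof (intro allI impI)
    fix g assume "aut g"
    then have "drop_map g u \<in> aut_orbit u" unfolding aut_orbit_def using drop_map_iso by blast
    then have "\<phi> (drop_map g u) \<in> aut_orbit u" using assms(4) by blast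
    then obtain \<alpha> where \<alpha>: "\<phi> (drop_map g u) = \<alpha> u" "\<alpha> \<in> iso F2 F2"
      unfolding aut_orbit_def by blast
    have "lift_map \<phi> (g v) = lift_map \<alpha> v"
      using \<alpha>(1) by (simp add: lift_map_def Rep_v) (simp add: drop_map_def v_def)
    then show "\<exists>h. aut h \<and> lift_map \<phi> (g v) = h v" using \<alpha>(2) iso_F2_iff by blast
  qed
  moreover have "v \<noteq> 0"
    using assms(2) Rep_v by (auto simp: one_F2 Rep_zero)
  ultimately have "aut (lift_map \<phi>)"
    using aut_if_preserves_orbit[OF grp_hom_lift_map[OF assms(3)]] by blast
  then show ?thesis using assms(3) by (simp add: iso_F2_iff)
qed

end
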